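(* There exists an absolute constant $c>0$ such that the following holds. Let $A\subset\mathbb{T}$ be closed and suppose $\mu(A+A)<c$. Then $\mu(A+A+A)\geq\frac{3}{2}\mu(A+A)$.
   Context: $\mathbb{T}=\mathbb{R}/\mathbb{Z}$ with its Haar probability measure $\mu$; sums of sets are Minkowski sums (for closed $A$, the sets $A+A$ and $A+A+A$ are compact, hence measurable). *)

theory Defs
  imports "HOL-Analysis.Analysis"
begin

section \<open>The circle group $\mathbb{R}/\mathbb{Z}$\<close>

quotient_type circle = real / "\<lambda>x y :: real. x - y \<in> \<int>"
  morphisms rep_circle to_circle
proof (rule equivpI)
  show "reflp (\<lambda>x y :: real. x - y \<in> \<int>)"
    by (simp add: reflp_def)
  show "symp (\<lambda>x y :: real. x - y \<in> \<int>)"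
    by (rule sympI) (use Ints_minus in fastforce)
  show "transp (\<lambda>x y :: real. x - y \<in> \<int>)"
    by (rule transpI) (use Ints_add in fastforce)
qed

lemma to_circle_eq_iff: "to_circle x = to_circle y \<longleftrightarrow> x - y \<in> \<int>"
  by (rule circle.abs_eq_iff)

lemma to_circle_cases: obtains x where "z = to_circle x"
  using circle.abs_induct[of "\<lambda>z. \<exists>x. z = to_circle x" z] by blast

instantiation circle :: ab_group_add
begin

lift_definition zero_circle :: circle is "0 :: real" .

lift_definition plus_circle :: "circle \<Rightarrow> circle \<Rightarrow> circle" is "(+) :: real \<Rightarrow> real \<Rightarrow> real"
  by (simp add: add_diff_add)

lift_definition uminus_circle :: "circle \<Rightarrow> circle" is "uminus :: real \<Rightarrow> real"
  by (use Ints_minus in fastforce)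

lift_definition minus_circle :: "circle \<Rightarrow> circle \<Rightarrow> circle" is "(-) :: real \<Rightarrow> real \<Rightarrow> real"
proof -
  fix a b c d :: real
  assume "a - b \<in> \<int>" "c - d \<in> \<int>"
  then have "(a - b) - (c - d) \<in> \<int>" by (rule Ints_diff)
  then show "(a - c) - (b - d) \<in> \<int>" by (simp add: algebra_simps)
qed

instance
  by standard (transfer; simp)+

end

lemma to_circle_add: "to_circle (x + y) = to_circle x + to_circle y"
  by (simp add: plus_circle.abs_eq)

lemma to_circle_minus: "to_circle (- x) = - to_circle x"
  by (simp add: uminus_circle.abs_eq)

instantiation circle :: topological_space
begin

definition open_circle :: "circle set \<Rightarrow> bool"
  where "open_circle U \<longleftrightarrow> open (to_circle -` U)"

instance
proof
  show "open (UNIV :: circle set)"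
    by (simp add: open_circle_def)
  show "open (S \<inter> T)" if "open S" "open T" for S T :: "circle set"
    using that by (simp add: open_circle_def open_Int)
  show "open (\<Union>K)" if "\<forall>S\<in>K. open S" for K :: "circle set set"
    using that by (auto simp: open_circle_def vimage_Union)
qed

end

lemma continuous_on_to_circle: "continuous_on S to_circle"
  by (rule continuous_on_subset[of UNIV]) (auto simp: continuous_on_open_vimage open_circle_def)

lemma open_to_circle_image:
  assumes "open S"
  shows "open (to_circle ` S)"
proof -
  have "to_circle -` to_circle ` S = (\<Union>k\<in>\<int>. (+) k ` S)"
  proof (intro equalityI subsetI)
    fix x assume "x \<in> to_circle -` to_circle ` S"
    then obtain y where y: "y \<in> S" "x - y \<in> \<int>"
      by (auto simp: to_circle_eq_iff)
    then have "x \<in> (+) (x - y) ` S"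
      by (auto simp: image_iff)
    with y show "x \<in> (\<Union>k\<in>\<int>. (+) k ` S)" by blast
  next
    fix x assume "x \<in> (\<Union>k\<in>\<int>. (+) k ` S)"
    then obtain k y where "k \<in> \<int>" "y \<in> S" "x = k + y" by auto
    then have "to_circle x = to_circle y" by (simp add: to_circle_eq_iff)
    with \<open>y \<in> S\<close> show "x \<in> to_circle -` to_circle ` S" by auto
  qed
  then show ?thesis
    using assms by (auto simp: open_circle_def intro: open_translation)
qed

instance circle :: topological_ab_group_add
proof
  fix a b :: circle
  obtain x y where xy: "a = to_circle x" "b = to_circle y"
    by (metis to_circle_cases)
  show "((\<lambda>z. fst z + snd z) \<longlongrightarrow> a + b) (nhds a \<times>\<^sub>F nhds b)"
  proof (rule topological_tendstoI)
    fix U assume U: "open U" "a + b \<in> U"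
    have "((\<lambda>z. fst z + snd z) \<longlongrightarrow> x + y) (nhds x \<times>\<^sub>F nhds y)"
      by (rule tendsto_add_Pair)
    moreover have "open (to_circle -` U)" "x + y \<in> to_circle -` U"
      using U by (auto simp: open_circle_def xy to_circle_add)
    ultimately have "\<forall>\<^sub>F z in nhds x \<times>\<^sub>F nhds y. fst z + snd z \<in> to_circle -` U"
      by (rule topological_tendstoD)
    then obtain P Q where PQ: "eventually P (nhds x)" "eventually Q (nhds y)"
        "\<And>u v. P u \<Longrightarrow> Q v \<Longrightarrow> u + v \<in> to_circle -` U"
      by (auto simp: eventually_prod_filter)
    obtain S where S: "open S" "x \<in> S" "\<And>u. u \<in> S \<Longrightarrow> P u"
      using PQ(1) by (auto simp: eventually_nhds)
    obtain T where T: "open T" "y \<in> T" "\<And>u. u \<in> T \<Longrightarrow> Q u"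
      using PQ(2) by (auto simp: eventually_nhds)
    have "\<forall>\<^sub>F u in nhds a. u \<in> to_circle ` S" "\<forall>\<^sub>F u in nhds b. u \<in> to_circle ` T"
      using S T by (auto simp: xy intro!: eventually_nhds_in_open open_to_circle_image)
    moreover have "u + v \<in> U" if "u \<in> to_circle ` S" "v \<in> to_circle ` T" for u v
      using that S(3) T(3) PQ(3) by (force simp: to_circle_add)
    ultimately show "\<forall>\<^sub>F z in nhds a \<times>\<^sub>F nhds b. fst z + snd z \<in> U"
      unfolding eventually_prod_filter by (metis fst_conv snd_conv)
  qed
  show "(uminus \<longlongrightarrow> - a) (nhds a)"
  proof (rule topological_tendstoI)
    fix U assume U: "open U" "- a \<in> U"
    have "open (to_circle -` U)"
      using U(1) by (simp add: open_circle_def)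
    then have "open (uminus -` (to_circle -` U))"
      by (rule open_vimage) (intro continuous_intros)
    moreover have "uminus -` (to_circle -` U) = to_circle -` (uminus -` U)"
      by (auto simp: to_circle_minus)
    ultimately have "open ((uminus :: circle \<Rightarrow> circle) -` U)"
      by (simp add: open_circle_def)
    then have "\<forall>\<^sub>F u in nhds a. u \<in> uminus -` U"
      using U(2) by (intro eventually_nhds_in_open) auto
    then show "\<forall>\<^sub>F u in nhds a. - u \<in> U" by simp
  qed
qed


section \<open>Haar probability measure\<close>

text \<open>
  Haar measure on the circle is the image of Lebesgue measure on the fundamental
  domain $[0,1)$. The lemmas below show that it is a translation-invariant Borel
  probability measure, which determines it uniquely.
\<close>

definition haar_circle :: "circle measure"
  where "haar_circle = distr (restrict_space lborel {0..<1}) borel to_circle"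

lemma sets_haar_circle [simp, measurable_cong]: "sets haar_circle = sets borel"
  by (simp add: haar_circle_def)

lemma space_haar_circle [simp]: "space haar_circle = UNIV"
  by (simp add: haar_circle_def)

lemma measurable_to_circle [measurable]: "to_circle \<in> borel_measurable borel"
  by (rule borel_measurable_continuous_onI) (rule continuous_on_to_circle)

lemma emeasure_haar_circle:
  assumes "A \<in> sets borel"
  shows "emeasure haar_circle A = emeasure lborel (to_circle -` A \<inter> {0..<1})"
proof -
  have "to_circle \<in> measurable (restrict_space lborel {0..<1}) borel"
    by (intro measurable_restrict_space1) simp
  then show ?thesis
    using assms by (simp add: haar_circle_def emeasure_distr emeasure_restrict_space)
qed

lemma emeasure_haar_circle_UNIV: "emeasure haar_circle UNIV = 1"
  by (simp add: emeasure_haar_circle)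

lemma measurable_plus_circle: "(\<lambda>y. a + y) \<in> borel_measurable (borel :: circle measure)"
  by (intro borel_measurable_continuous_onI continuous_intros)

lemma emeasure_lborel_shift:
  assumes "S \<in> sets borel"
  shows "emeasure lborel ((\<lambda>x. t + x) -` S) = emeasure lborel (S :: real set)"
proof -
  have "emeasure lborel S = emeasure (distr lborel borel ((+) t)) S"
    by (simp add: lborel_distr_plus)
  also have "\<dots> = emeasure lborel ((\<lambda>x. t + x) -` S)"
    using assms by (subst emeasure_distr) auto
  finally show ?thesis by simp
qed

lemma haar_circle_translation_invariant: "distr haar_circle borel (\<lambda>y. a + y) = haar_circle"
proof (rule measure_eqI)
  fix A assume "A \<in> sets (distr haar_circle borel (\<lambda>y. a + y))"
  then have A: "A \<in> sets borel" by simp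
  obtain s where "a = to_circle s" by (rule to_circle_cases)
  define t where "t = frac s"
  have t: "a = to_circle t" "0 \<le> t" "t < 1"
    unfolding t_def by (auto simp: \<open>a = _\<close> to_circle_eq_iff frac_def frac_lt_1 frac_ge_0)
      (use frac_lt_1[of s] in \<open>simp add: frac_def\<close>)
  define P where "P = to_circle -` A"
  have P [measurable]: "P \<in> sets borel"
    using measurable_sets[OF measurable_to_circle A] by (simp add: P_def)
  have per: "1 + x \<in> P \<longleftrightarrow> x \<in> P" for x
  proof -
    have "to_circle (1 + x) = to_circle x" by (simp add: to_circle_eq_iff)
    then show ?thesis by (simp add: P_def)
  qed
  have "emeasure (distr haar_circle borel (\<lambda>y. a + y)) A = emeasure haar_circle ((\<lambda>y. a + y) -` A)"
    using A measurable_plus_circle by (subst emeasure_distr) (auto cong: measurable_cong_sets)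
  also have "\<dots> = emeasure lborel (to_circle -` ((\<lambda>y. a + y) -` A) \<inter> {0..<1})"
    using measurable_sets[OF measurable_plus_circle A] by (intro emeasure_haar_circle) simp
  also have "to_circle -` ((\<lambda>y. a + y) -` A) \<inter> {0..<1} = (\<lambda>x. t + x) -` (P \<inter> {t..<t+1})"
    by (auto simp: P_def t to_circle_add)
  also have "emeasure lborel \<dots> = emeasure lborel (P \<inter> {t..<t+1})"
    by (rule emeasure_lborel_shift) simp
  also have "P \<inter> {t..<t+1} = (P \<inter> {t..<1}) \<union> (P \<inter> {1..<t+1})"
    using t by auto
  also have "emeasure lborel \<dots> = emeasure lborel (P \<inter> {t..<1}) + emeasure lborel (P \<inter> {1..<t+1})"
    by (subst plus_emeasure) auto
  also have "emeasure lborel (P \<inter> {1..<t+1}) = emeasure lborel ((\<lambda>x. 1 + x) -` (P \<inter> {1..<t+1}))"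
    by (rule emeasure_lborel_shift[symmetric]) simp
  also have "(\<lambda>x. 1 + x) -` (P \<inter> {1..<t+1}) = P \<inter> {0..<t}"
    by (auto simp: per)
  also have "emeasure lborel (P \<inter> {t..<1}) + emeasure lborel (P \<inter> {0..<t})
      = emeasure lborel ((P \<inter> {t..<1}) \<union> (P \<inter> {0..<t}))"
    by (subst plus_emeasure) auto
  also have "(P \<inter> {t..<1}) \<union> (P \<inter> {0..<t}) = P \<inter> {0..<1}"
    using t by auto
  also have "emeasure lborel \<dots> = emeasure haar_circle A"
    using A by (simp add: emeasure_haar_circle P_def)
  finally show "emeasure (distr haar_circle borel (\<lambda>y. a + y)) A = emeasure haar_circle A" .
qed simp

end

theory Submission
  imports Defs "HOL-Computational_Algebra.Primes" "HOL-Real_Asymp.Real_Asymp"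
begin

text \<open>
  For a finite set of reals with minimum \<open>m\<close> and maximum \<open>M\<close>, cutting \<open>2A\<close> at each of
  \<open>2m\<close>, \<open>m + M\<close>, \<open>2M\<close> gives $2|3A| \geq 3|2A| - 3$. The same bound holds for a set \<open>A\<close> of
  \<open>p\<close>-torsion points of the circle, \<open>p\<close> prime, with $|2A| \leq cp$: if it failed, then
  $|3A| < \frac32|2A|$, and Petridis' lemma with Ruzsa's triangle and covering lemmas gives
  polynomial growth of \<open>hA + X - X\<close> for some $X \subseteq 2A$. So some set \<open>S\<close>, still small
  compared with \<open>p\<close>, is almost invariant under \<open>2A\<close>, which forces a nontrivial Fourier
  coefficient of \<open>2A\<close> to be nearly maximal. Any two translates \<open>a + 2A\<close>, \<open>a' + 2A\<close> share more
  than half of their points, hence that character varies little on \<open>A\<close> itself, and its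
  argument is a Freiman isomorphism from \<open>A\<close> to the reals. For closed \<open>A\<close>, apply the
  bound to the \<open>p\<close>-torsion points near \<open>A\<close> and let \<open>p\<close> tend to infinity.
\<close>

section \<open>Sumset inequalities in abelian groups\<close>

lemma card_translate: "card ((+) (c::'a::ab_group_add) ` S) = card S"
  by (simp add: card_image)

lemma set_plus_uminus_mem: "x \<in> X \<Longrightarrow> y \<in> Y \<Longrightarrow> x - y \<in> X + uminus ` (Y :: 'a::ab_group_add set)"
  unfolding set_plus_def by (auto simp: diff_conv_add_uminus simp del: add_uminus_conv_diff)

lemma card_set_plus_pos:
  assumes "finite A" "finite B" "A \<noteq> {}" "B \<noteq> {}"
  shows "card (A + B :: 'a::ab_group_add set) > 0"
  using assms by (auto simp: card_gt_0_iff set_plus_def intro!: finite_set_plus[unfolded set_plus_def])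

lemma card_set_plus_le:
  assumes "finite A" "finite B"
  shows "card (A + B) \<le> card A * card B"
  unfolding set_plus_image
  using card_image_le[of "A \<times> B"] assms by (simp add: card_cartesian_product)

text \<open>Take \<open>X\<close> to minimise the ratio of \<open>card (X + A)\<close> to
  \<open>card X\<close> over the nonempty subsets of \<open>B\<close>; comparison with
  \<open>B\<close> itself gives the first bound. The second follows by induction on
  \<open>C\<close>, adding one translate at a time.\<close>

lemma petridis:
  fixes A B :: "'a::ab_group_add set"
  assumes A: "finite A" and B: "finite B" "B \<noteq> {}"
  obtains X where "X \<subseteq> B" "X \<noteq> {}" "card (X + A) * card B \<le> card (B + A) * card X"
    "\<And>C. finite C \<Longrightarrow> card (X + A + C) * card X \<le> card (X + A) * card (X + C)"
proof -
  let ?r = "\<lambda>X. real (card (X + A)) / card X"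
  let ?P = "Pow B - {{}}"
  have "finite ?P" "?P \<noteq> {}" using B by auto
  then obtain X where X: "X \<in> ?P" and "\<forall>Y\<in>?P. ?r X \<le> ?r Y"
    using ex_min_if_finite[of "?r ` ?P"] by (metis (no_types, lifting) arg_min_if_finite(1) arg_min_least)
  have finX: "finite X" using X B finite_subset by auto
  have pos: "card X > 0" using X finX by (auto simp: card_gt_0_iff)
  have min: "card (X + A) * card Y \<le> card (Y + A) * card X" if "Y \<subseteq> B" for Y
  proof (cases "Y = {}")
    case False
    have "finite Y" using that B finite_subset by auto
    then have "card Y > 0" using False by (auto simp: card_gt_0_iff)
    moreover have "?r X \<le> ?r Y" using \<open>\<forall>Y\<in>?P. _\<close> that False by auto
    ultimately have "real (card (X + A) * card Y) \<le> real (card (Y + A) * card X)"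
      using pos by (simp add: field_simps)
    then show ?thesis by linarith
  qed simp
  have "card (X + A + C) * card X \<le> card (X + A) * card (X + C)" if "finite C" for C
    using that
  proof (induction C)
    case empty
    then show ?case by (simp add: set_plus_def)
  next
    case (insert c C)
    \<comment> \<open>\<open>W + c\<close> is the part of the new translate already covered; minimality of \<open>X\<close>
      bounds \<open>card (W + A)\<close> from below.\<close>
    define W where "W = {x \<in> X. x + c \<in> X + C}"
    have WX: "W \<subseteq> X" by (auto simp: W_def)
    then have finW: "finite W" using finX finite_subset by auto
    have "X + insert c C = (X + C) \<union> (+) c ` (X - W)"
      by (auto simp: set_plus_def W_def add.commute)
    moreover have "(X + C) \<inter> (+) c ` (X - W) = {}"
      by (auto simp: W_def add.commute)
    ultimately have "card (X + insert c C) = card (X + C) + card (X - W)"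
      using finX insert.hyps by (simp add: card_Un_disjoint finite_set_plus card_translate)
    then have 1: "card (X + insert c C) + card W = card (X + C) + card X"
      using WX finX using card_mono[OF finX WX] by (simp add: card_Diff_subset finW)
    have "X + A + insert c C \<subseteq> (X + A + C) \<union> (+) c ` ((X + A) - (W + A))"
    proof
      fix t assume "t \<in> X + A + insert c C"
      then obtain x a d where t: "t = x + a + d" "x \<in> X" "a \<in> A" "d \<in> insert c C"
        by (auto simp: set_plus_def)
      show "t \<in> (X + A + C) \<union> (+) c ` ((X + A) - (W + A))"
      proof (cases "d \<in> C")
        case True
        then show ?thesis using t by (auto intro!: set_plus_intro)
      next
        case False
        then have d: "d = c" using t by auto
        show ?thesis
        proof (cases "x + a \<in> W + A")
          case True
          then obtain w b where w: "x + a = w + b" "w \<in> W" "b \<in> A"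
            by (auto simp: set_plus_def)
          from w(2) obtain x' c' where x': "w + c = x' + c'" "x' \<in> X" "c' \<in> C"
            by (auto simp: W_def set_plus_def)
          have "t = w + c + b" using w(1) d t(1) by (metis add.assoc add.commute)
          then have "t = x' + b + c'" using x'(1) by (metis add.assoc add.commute)
          then show ?thesis using x' w(3) by (auto intro!: set_plus_intro)
        next
          case False
          then have "x + a \<in> (X + A) - (W + A)" using t by auto
          moreover have "t = c + (x + a)" using t(1) d by (simp add: add.commute)
          ultimately show ?thesis by blast
        qed
      qed
    qed
    then have "card (X + A + insert c C) \<le> card ((X + A + C) \<union> (+) c ` ((X + A) - (W + A)))"
      using A finX insert.hyps by (intro card_mono) (auto intro!: finite_set_plus)
    also have "\<dots> \<le> card (X + A + C) + card ((X + A) - (W + A))"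
      by (metis card_Un_le card_translate)
    finally have 2: "card (X + A + insert c C) + card (W + A) \<le> card (X + A + C) + card (X + A)"
      using card_Diff_subset[of "W + A" "X + A"] card_mono[of "X + A" "W + A"] WX finX A finW
      by (simp add: finite_set_plus set_plus_mono2)
    have 3: "card (X + A) * card W \<le> card (W + A) * card X"
      using min WX X by auto
    have "card (X + A + insert c C) * card X + card (W + A) * card X
      \<le> card (X + A + C) * card X + card (X + A) * card X"
      using mult_le_mono1[OF 2, of "card X"] by (simp add: algebra_simps)
    also have "\<dots> \<le> card (X + A) * card (X + C) + card (X + A) * card X"
      using insert.IH by simp
    also have "\<dots> = card (X + A) * card (X + insert c C) + card (X + A) * card W"
      using 1 by (metis distrib_left)
    finally show ?case using 3 by linarith
  qed
  moreover have "card (X + A) * card B \<le> card (B + A) * card X" using min[of B] by simp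
  ultimately show ?thesis using that X by auto
qed

text \<open>Fix one representation \<open>d = y d - z d\<close> of each difference. The pair
  \<open>(x + y d, x + z d)\<close> determines \<open>d\<close> by subtraction and then
  \<open>x\<close>, so the product on the left injects into the product on the right.\<close>

lemma ruzsa_triangle:
  fixes X Y Z :: "'a::ab_group_add set"
  assumes "finite X" "finite Y" "finite Z"
  shows "card X * card (Y + uminus ` Z) \<le> card (X + Y) * card (X + Z)"
proof -
  have "\<forall>d\<in>Y + uminus ` Z. \<exists>y z. y \<in> Y \<and> z \<in> Z \<and> d = y - z"
    by (auto simp: set_plus_def)
  then obtain y z where yz: "\<And>d. d \<in> Y + uminus ` Z \<Longrightarrow> y d \<in> Y \<and> z d \<in> Z \<and> d = y d - z d"
    by metis
  let ?f = "\<lambda>(x, d). (x + y d, x + z d)"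
  have "inj_on ?f (X \<times> (Y + uminus ` Z))"
  proof (rule inj_onI, clarify)
    fix x d x' d'
    assume d: "d \<in> Y + uminus ` Z" "d' \<in> Y + uminus ` Z"
      and eq: "x + y d = x' + y d'" "x + z d = x' + z d'"
    have "d = (x + y d) - (x + z d)" using yz[OF d(1)] by simp
    also have "\<dots> = d'" unfolding eq using yz[OF d(2)] by simp
    finally show "x = x' \<and> d = d'" using eq by simp
  qed
  moreover have "?f ` (X \<times> (Y + uminus ` Z)) \<subseteq> (X + Y) \<times> (X + Z)"
    using yz by (auto intro!: set_plus_intro)
  ultimately have "card (X \<times> (Y + uminus ` Z)) \<le> card ((X + Y) \<times> (X + Z))"
    using assms by (intro card_inj_on_le) (auto intro!: finite_set_plus)
  then show ?thesis by (simp add: card_cartesian_product)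
qed

text \<open>\<open>F\<close> is a maximal subset of \<open>Y\<close> whose translates
  \<open>f + X\<close> are pairwise disjoint. By maximality every \<open>y + X\<close> meets some
  \<open>f + X\<close>, which puts \<open>y\<close> in \<open>f + X - X\<close>.\<close>

lemma ruzsa_covering:
  fixes X Y :: "'a::ab_group_add set"
  assumes "finite X" "X \<noteq> {}" "finite Y"
  obtains F where "F \<subseteq> Y" "card F * card X \<le> card (Y + X)" "Y \<subseteq> F + (X + uminus ` X)"
proof -
  \<comment> \<open>Injectivity of addition on \<open>F \<times> X\<close> encodes disjointness of
    the translates and also yields \<open>card F * card X\<close> as the size of their
    union.\<close>
  let ?inj = "\<lambda>F. inj_on (\<lambda>(f, x). f + x) (F \<times> X)"
  have "finite {F. F \<subseteq> Y \<and> ?inj F}" "{} \<in> {F. F \<subseteq> Y \<and> ?inj F}"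
    using assms by auto
  then obtain F where F: "F \<subseteq> Y" "?inj F"
    and max: "\<And>G. G \<subseteq> Y \<Longrightarrow> ?inj G \<Longrightarrow> F \<subseteq> G \<Longrightarrow> F = G"
    using finite_has_maximal2[of "{F. F \<subseteq> Y \<and> ?inj F}" "{}"] by auto
  have "card F * card X = card ((\<lambda>(f, x). f + x) ` (F \<times> X))"
    using F(2) by (simp add: card_image card_cartesian_product)
  also have "\<dots> \<le> card (Y + X)"
    using F(1) assms by (intro card_mono finite_set_plus) (auto intro!: set_plus_intro)
  finally have "card F * card X \<le> card (Y + X)" .
  moreover have "y \<in> F + (X + uminus ` X)" if y: "y \<in> Y" for y
  proof (cases "y \<in> F")
    case True
    obtain x where "x \<in> X" using assms by auto
    then have "y + (x - x) \<in> F + (X + uminus ` X)"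
      using True by (intro set_plus_intro set_plus_uminus_mem)
    then show ?thesis by simp
  next
    case False
    then have "\<not> ?inj (insert y F)" using max[of "insert y F"] y F(1) by auto
    \<comment> \<open>A collision must involve \<open>y\<close> and exactly one element of
      \<open>F\<close>: equal translates force \<open>x = x'\<close>, and two elements of
      \<open>F\<close> contradict injectivity.\<close>
    then obtain f x g x' where *: "f \<in> insert y F" "g \<in> insert y F" "x \<in> X" "x' \<in> X"
        "f + x = g + x'" "(f, x) \<noteq> (g, x')"
      by (auto simp: inj_on_def)
    have "f = g \<Longrightarrow> False" using * by auto
    moreover have False if "f \<in> F" "g \<in> F"
    proof -
      have "(f, x) = (g, x')" by (rule inj_onD[OF F(2)]) (use * that in auto)
      then show False using *(6) by contradiction
    qed
    ultimately consider "f = y" "g \<in> F" | "g = y" "f \<in> F" using *(1,2) by auto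
    then show ?thesis
    proof cases
      case 1
      then have "y = g + (x' - x)" using *(5) by (metis add_diff_cancel_right' add_diff_eq)
      then show ?thesis using 1 * by (auto intro!: set_plus_intro set_plus_uminus_mem)
    next
      case 2
      then have "y = f + (x - x')" using *(5) by (metis add_diff_cancel_right' add_diff_eq)
      then show ?thesis using 2 * by (auto intro!: set_plus_intro set_plus_uminus_mem)
    qed
  qed
  ultimately show ?thesis using that F(1) by blast
qed

section \<open>Growth of \<open>((+) A ^^ n) X\<close>, the sum of \<open>X\<close> and
  \<open>n\<close> copies of \<open>A\<close>\<close>

lemma finite_funpow_set_plus:
  fixes A X :: "'a::ab_group_add set"
  shows "finite A \<Longrightarrow> finite X \<Longrightarrow> finite (((+) A ^^ n) X)"
  by (induction n) (auto intro: finite_set_plus)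

lemma funpow_set_plus_commute:
  "((+) A ^^ n) (X + Y) = ((+) A ^^ n) X + (Y :: 'a::ab_group_add set)"
  by (induction n) (auto simp: add.assoc)

text \<open>By commutativity an \<open>h\<close>-fold sum depends only on how often each element of
  \<open>F\<close> occurs, and each multiplicity is one of \<open>h + 1\<close> values. This is the
  source of polynomial growth.\<close>

lemma card_iterated_sumset_le:
  fixes F :: "'a::ab_group_add set"
  assumes "finite F"
  shows "card (((+) F ^^ h) {0}) \<le> (h + 1) ^ card F"
proof -
  \<comment> \<open>The inner sum is the \<open>m x\<close>-fold multiple of
    \<open>x\<close>.\<close>
  let ?g = "\<lambda>m. \<Sum>x\<in>F. \<Sum>i<m x. x"
  have "((+) F ^^ h) {0} \<subseteq> ?g ` (F \<rightarrow>\<^sub>E {..h})"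
  proof (induction h)
    case 0
    have "0 = ?g (\<lambda>x\<in>F. 0::nat)" by simp
    then show ?case by (auto intro!: image_eqI[of _ _ "\<lambda>x\<in>F. 0::nat"])
  next
    case (Suc h)
    show ?case
    proof
      fix t assume "t \<in> ((+) F ^^ Suc h) {0}"
      then obtain f s where t: "t = f + s" "f \<in> F" "s \<in> ((+) F ^^ h) {0}"
        by (auto simp: set_plus_def)
      then obtain m where m: "s = ?g m" "m \<in> F \<rightarrow>\<^sub>E {..h}" using Suc by auto
      define m' where "m' = m(f := Suc (m f))"
      have m': "m' \<in> F \<rightarrow>\<^sub>E {..Suc h}"
        using m(2) t(2) by (auto simp: m'_def PiE_iff extensional_def le_Suc_eq)
      have "?g m' = (\<Sum>i<m' f. f) + (\<Sum>x\<in>F - {f}. \<Sum>i<m' x. x)"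
        using assms t(2) by (rule sum.remove)
      also have "(\<Sum>x\<in>F - {f}. \<Sum>i<m' x. x) = (\<Sum>x\<in>F - {f}. \<Sum>i<m x. x)"
        by (intro sum.cong) (auto simp: m'_def)
      also have "(\<Sum>i<m' f. f) = f + (\<Sum>i<m f. f)"
        by (simp add: m'_def add.commute)
      also have "f + (\<Sum>i<m f. f) + (\<Sum>x\<in>F - {f}. \<Sum>i<m x. x) = f + ?g m"
        using assms t(2) by (simp add: sum.remove[of F f] add.assoc)
      finally have "t = ?g m'" using t(1) m(1) by simp
      then show "t \<in> ?g ` (F \<rightarrow>\<^sub>E {..Suc h})" using m' by blast
    qed
  qed
  then have "card (((+) F ^^ h) {0}) \<le> card (?g ` (F \<rightarrow>\<^sub>E {..h}))"
    using assms by (intro card_mono) (auto intro: finite_PiE)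
  also have "\<dots> \<le> card (F \<rightarrow>\<^sub>E {..h})"
    using assms by (intro card_image_le) (auto intro: finite_PiE)
  also have "\<dots> = (h + 1) ^ card F"
    using assms by (simp add: card_PiE)
  finally show ?thesis .
qed

text \<open>The summand \<open>D\<close> stays available throughout, so copies of \<open>A\<close>
  are exchanged one after the other for copies of the bounded set \<open>F\<close>.\<close>

lemma funpow_set_plus_subset_of_cover:
  fixes A F D :: "'a::ab_group_add set"
  assumes "A + D \<subseteq> F + D"
  shows "((+) A ^^ h) D \<subseteq> ((+) F ^^ h) {0} + D"
proof (induction h)
  case (Suc h)
  have "((+) A ^^ Suc h) D \<subseteq> A + (((+) F ^^ h) {0} + D)"
    using Suc by (simp add: set_plus_mono2)
  also have "\<dots> = ((+) F ^^ h) {0} + (A + D)"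
    by (simp add: ac_simps)
  also have "\<dots> \<subseteq> ((+) F ^^ h) {0} + (F + D)"
    by (intro set_plus_mono2 assms order_refl)
  also have "\<dots> = (F + ((+) F ^^ h) {0}) + D"
    by (metis add.assoc add.commute)
  finally show ?case by simp
qed simp

text \<open>With \<open>C\<close> the \<open>n\<close>-fold sumset of \<open>A\<close>, Petridis'
  inequality says that one more summand \<open>A\<close> enlarges \<open>X + C\<close> by no larger
  a factor than it enlarges \<open>X\<close>.\<close>

lemma card_funpow_set_plus_le:
  fixes A X :: "'a::ab_group_add set" and K :: real
  assumes "finite A" "finite X" "X \<noteq> {}" "real (card (X + A)) \<le> K * card X"
    and petr: "\<And>C. finite C \<Longrightarrow> card (X + A + C) * card X \<le> card (X + A) * card (X + C)"
  shows "real (card (((+) A ^^ n) X)) \<le> K ^ n * card X"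
proof (induction n)
  case (Suc n)
  define C where "C = ((+) A ^^ n) {0}"
  have fC: "finite C" unfolding C_def by (intro finite_funpow_set_plus assms(1)) simp
  have XC: "((+) A ^^ n) X = X + C"
    using funpow_set_plus_commute[of n A "{0}" X] by (simp add: C_def add.commute)
  have pos: "card X > 0" using assms by (simp add: card_gt_0_iff)
  have "0 \<le> K * card X" using assms(4) by (meson of_nat_0_le_iff order_trans)
  then have K: "0 \<le> K" using pos by (simp add: zero_le_mult_iff)
  have "real (card (X + A + C)) * card X \<le> real (card (X + A)) * card (X + C)"
    using petr[OF fC] by (metis of_nat_le_iff of_nat_mult)
  also have "\<dots> \<le> (K * card X) * card (X + C)"
    using assms(4) by (intro mult_right_mono) auto
  finally have "real (card (X + A + C)) \<le> K * card (X + C)"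
    using pos by (simp add: mult.assoc mult.commute mult.left_commute)
  also have "\<dots> \<le> K * (K ^ n * card X)"
    using Suc XC K by (intro mult_left_mono) auto
  finally show ?case unfolding funpow.simps o_apply XC by (simp add: ac_simps)
qed simp

text \<open>
  The clause on \<open>H\<close> says that \<open>S\<close> lies in every subgroup containing \<open>A\<close>; it keeps \<open>S\<close>
  inside the torsion subgroup on which Fourier inversion is available.
\<close>

lemma exists_almost_invariant_set:
  fixes \<epsilon> :: real
  assumes "\<epsilon> > 0"
  shows "\<exists>C::real. 0 < C \<and> (\<forall>A :: 'a::ab_group_add set. finite A \<longrightarrow> A \<noteq> {} \<longrightarrow>
    2 * card (A + A + A) \<le> 3 * card (A + A) \<longrightarrow>
    (\<exists>S. finite S \<and> S \<noteq> {} \<and> real (card (S + (A + A))) \<le> (1 + \<epsilon>) * card S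
      \<and> real (card S) \<le> C * card (A + A)
      \<and> (\<forall>H. A \<subseteq> H \<longrightarrow> (\<forall>x\<in>H. \<forall>y\<in>H. x - y \<in> H) \<longrightarrow> S \<subseteq> H)))"
proof -
  \<comment> \<open>The exponent 17 is the bound on the size of the covering set \<open>F\<close>
    below. \<open>N\<close> is chosen so that \<open>N\<close> successive growth factors
    \<open>1 + \<epsilon>\<close> outrun the polynomial bound for \<open>2 * N\<close> copies of
    \<open>A\<close>.\<close>
  have "eventually (\<lambda>n. (2 * real n + 1) ^ 17 < (1 + \<epsilon>) ^ n) at_top"
    using assms by real_asymp
  then obtain N where N: "(2 * real N + 1) ^ 17 < (1 + \<epsilon>) ^ N"
    by (auto simp: eventually_at_top_linorder)
  show ?thesis
  \<comment> \<open>The factor 6 bounds \<open>card D / card B\<close>, which is at most 81/16; the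
    power bounds the growth after at most \<open>2 * N\<close> summands.\<close>
  proof (intro exI[of _ "(2 * real N + 1) ^ 17 * 6"] conjI allI impI)
    show "0 < (2 * real N + 1) ^ 17 * 6" by (intro mult_pos_pos zero_less_power) auto
    fix A :: "'a set"
    assume A: "finite A" "A \<noteq> {}" and small: "2 * card (A + A + A) \<le> 3 * card (A + A)"
    define B where "B = A + A"
    have B: "finite B" "B \<noteq> {}"
      using A card_set_plus_pos[of A A] by (auto simp: B_def card_gt_0_iff)
    obtain X where X: "X \<subseteq> B" "X \<noteq> {}" "card (X + A) * card B \<le> card (B + A) * card X"
      and petr: "\<And>C. finite C \<Longrightarrow> card (X + A + C) * card X \<le> card (X + A) * card (X + C)"
      using petridis[OF A(1) B] by metis
    have finX: "finite X" using X(1) B(1) finite_subset by auto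
    have posX: "card X > 0" using finX X(2) by (simp add: card_gt_0_iff)
    have posB: "card B > 0" using B by (simp add: card_gt_0_iff)
    \<comment> \<open>The minimal ratio is at most the ratio for \<open>B = A + A\<close>, which the
      tripling hypothesis bounds by 3/2.\<close>
    have "2 * (card (X + A) * card B) \<le> 2 * (card (B + A) * card X)"
      using X(3) by simp
    also have "\<dots> = (2 * card (B + A)) * card X" by simp
    also have "\<dots> \<le> (3 * card B) * card X"
      using small unfolding B_def by (rule mult_le_mono1)
    finally have "(2 * card (X + A)) * card B \<le> (3 * card X) * card B" by (simp add: ac_simps)
    then have "2 * card (X + A) \<le> 3 * card X" using posB by simp
    then have XA: "real (card (X + A)) \<le> 3/2 * card X" by linarith
    have pw: "real (card (((+) A ^^ n) X)) \<le> (3/2) ^ n * card X" for n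
      by (rule card_funpow_set_plus_le[OF A(1) finX X(2) XA petr])
    have sub: "card U \<le> (3/2) ^ n * card X" if "U \<subseteq> ((+) A ^^ n) X" for U n
      using card_mono[OF finite_funpow_set_plus[OF A(1) finX] that] pw[of n] by linarith
    define D where "D = X + uminus ` X"
    have finD: "finite D" using finX by (auto simp: D_def intro!: finite_set_plus)
    have posD: "card D > 0" unfolding D_def by (rule card_set_plus_pos) (use finX X(2) in auto)
    have XX: "card (X + X) \<le> (3/2) ^ 2 * card X"
    proof (rule sub)
      have "X + X \<subseteq> (A + A) + X" using X(1) unfolding B_def by (intro set_plus_mono2 order_refl)
      then show "X + X \<subseteq> ((+) A ^^ 2) X" by (simp add: numeral_2_eq_2 add.assoc)
    qed
    \<comment> \<open>Ruzsa's triangle inequality for \<open>X\<close>, \<open>X\<close>,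
      \<open>X\<close>; since \<open>X + X\<close> lies in \<open>2A + X\<close>, the factor is
      \<open>(3/2)^4 = 81/16\<close>.\<close>
    have "real (card X) * card D \<le> real (card (X + X)) * card (X + X)"
      unfolding D_def using ruzsa_triangle[OF finX finX finX] by (metis of_nat_le_iff of_nat_mult)
    also have "\<dots> \<le> ((3/2) ^ 2 * card X) * ((3/2) ^ 2 * card X)"
      using XX by (intro mult_mono) auto
    finally have "card X * real (card D) \<le> card X * (81/16 * card X)"
      by (simp add: power2_eq_square)
    then have "card D \<le> 81/16 * real (card X)" using posX by simp
    also have "real (card X) \<le> card B" using X(1) B(1) by (simp add: card_mono)
    finally have DB: "card D \<le> 6 * real (card B)" by simp
    \<comment> \<open>This set is \<open>A + D + X\<close>, whose size controls the covering below.
      Replacing all but one \<open>X\<close> by \<open>A + A\<close> puts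
      \<open>X + (A + X + X)\<close> in \<open>5A + X\<close>, so the factor is
      \<open>(3/2)^7 = 2187/128\<close>, just above 17.\<close>
    have "real (card X) * card ((A + X + X) + uminus ` X) \<le> real (card (X + (A + X + X))) * card (X + X)"
      using ruzsa_triangle[OF finX finite_set_plus[OF finite_set_plus[OF A(1) finX] finX] finX]
      by (metis of_nat_le_iff of_nat_mult)
    also have "\<dots> \<le> ((3/2) ^ 5 * card X) * ((3/2) ^ 2 * card X)"
    proof (intro mult_mono XX sub)
      have "X + (A + X + X) \<subseteq> X + (A + (A + A) + (A + A))"
        using X(1) unfolding B_def by (intro set_plus_mono2 order_refl)
      also have "\<dots> = A + (A + (A + (A + (A + X))))" by (simp add: ac_simps)
      finally show "X + (A + X + X) \<subseteq> ((+) A ^^ 5) X" by (simp add: eval_nat_numeral)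
    qed auto
    finally have "card X * real (card ((A + X + X) + uminus ` X)) \<le> card X * (2187/128 * card X)"
      by (simp add: power_numeral_reduce)
    then have AXXX: "real (card ((A + X + X) + uminus ` X)) \<le> 2187/128 * card X"
      using posX by simp
    \<comment> \<open>Covering \<open>A + D\<close> by translates of \<open>X - X = D\<close> gives
      the hypothesis \<open>A + D \<subseteq> F + D\<close> of the exchange argument.\<close>
    obtain F where F: "F \<subseteq> A + D" "card F * card X \<le> card (A + D + X)" "A + D \<subseteq> F + D"
      using ruzsa_covering[OF finX X(2) finite_set_plus[OF A(1) finD]] unfolding D_def by blast
    have finF: "finite F" by (rule finite_subset[OF F(1) finite_set_plus[OF A(1) finD]])
    have ADX: "A + D + X = (A + X + X) + uminus ` X"
      unfolding D_def by (simp add: ac_simps)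
    have "real (card F * card X) \<le> real (card (A + D + X))"
      using F(2) by (rule of_nat_mono)
    also have "\<dots> \<le> 2187/128 * card X"
      using AXXX unfolding ADX .
    finally have "card X * real (card F) \<le> card X * (2187/128)"
      by (simp add: mult.commute)
    then have "real (card F) \<le> 2187/128" using posX by simp
    then have F17: "card F \<le> 17" by linarith
    define S where "S h = ((+) A ^^ h) D" for h
    have finS: "finite (S h)" for h unfolding S_def using A(1) finD by (rule finite_funpow_set_plus)
    have S_le: "real (card (S h)) \<le> (real h + 1) ^ 17 * card D" for h
    proof -
      have "card (S h) \<le> card (((+) F ^^ h) {0} + D)"
        unfolding S_def using finF finD funpow_set_plus_subset_of_cover[OF F(3)]
        by (intro card_mono finite_set_plus finite_funpow_set_plus) auto
      also have "\<dots> \<le> card (((+) F ^^ h) {0}) * card D"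
        using finF finD by (intro card_set_plus_le finite_funpow_set_plus) auto
      also have "\<dots> \<le> (h + 1) ^ card F * card D"
        by (intro mult_le_mono1 card_iterated_sumset_le finF)
      also have "\<dots> \<le> (h + 1) ^ 17 * card D"
        using F17 by (intro mult_le_mono1 power_increasing) auto
      finally have "real (card (S h)) \<le> real ((h + 1) ^ 17 * card D)" by (rule of_nat_mono)
      then show ?thesis by (simp add: add.commute)
    qed
    have S_step: "S (2 * j) + (A + A) = S (2 * Suc j)" for j
    proof -
      have "S (2 * Suc j) = A + (A + S (2 * j))" by (simp add: S_def)
      also have "\<dots> = S (2 * j) + (A + A)" by (simp add: ac_simps)
      finally show ?thesis by simp
    qed
    \<comment> \<open>Pigeonhole: growth by more than \<open>1 + \<epsilon>\<close> at each of the
      \<open>N\<close> steps would contradict the choice of \<open>N\<close>. Only even indices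
      occur because one step adds \<open>A + A\<close>.\<close>
    have "\<exists>j<N. real (card (S (2 * Suc j))) \<le> (1 + \<epsilon>) * card (S (2 * j))"
    proof (rule ccontr)
      assume "\<not> ?thesis"
      then have grow: "(1 + \<epsilon>) * card (S (2 * j)) \<le> real (card (S (2 * Suc j)))" if "j < N" for j
        using that by (meson linear not_le)
      have "(1 + \<epsilon>) ^ j * card D \<le> real (card (S (2 * j)))" if "j \<le> N" for j
        using that
      proof (induction j)
        case (Suc j)
        have "(1 + \<epsilon>) ^ Suc j * card D = (1 + \<epsilon>) * ((1 + \<epsilon>) ^ j * card D)" by simp
        also have "\<dots> \<le> (1 + \<epsilon>) * card (S (2 * j))"
          using Suc assms by (intro mult_left_mono) auto
        also have "\<dots> \<le> real (card (S (2 * Suc j)))" using Suc.prems by (intro grow) auto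
        finally show ?case .
      qed (simp add: S_def)
      from this[of N] have "(1 + \<epsilon>) ^ N * card D \<le> (2 * real N + 1) ^ 17 * card D"
        using S_le[of "2 * N"] by simp
      then show False using N posD by simp
    qed
    then obtain j where j: "j < N" "real (card (S (2 * Suc j))) \<le> (1 + \<epsilon>) * card (S (2 * j))"
      by auto
    have "S (2 * j) \<noteq> {}"
    proof -
      have "S h \<noteq> {}" for h
      proof (induction h)
        case 0
        then show ?case using posD by (auto simp: S_def)
      next
        case (Suc h)
        have "S (Suc h) = A + S h" by (simp add: S_def)
        then show ?case using card_set_plus_pos[OF A(1) finS[of h] A(2) Suc] by auto
      qed
      then show ?thesis .
    qed
    moreover have "real (card (S (2 * j))) \<le> (2 * real N + 1) ^ 17 * 6 * card (A + A)"
    proof -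
      have "real (card (S (2 * j))) \<le> (real (2 * j) + 1) ^ 17 * card D" by (rule S_le)
      also have "\<dots> \<le> (2 * real N + 1) ^ 17 * (6 * card B)"
        using j(1) DB by (intro mult_mono power_mono) auto
      finally show ?thesis by (simp add: B_def ac_simps)
    qed
    moreover have "S (2 * j) \<subseteq> H" if "A \<subseteq> H" and diff: "\<forall>x\<in>H. \<forall>y\<in>H. x - y \<in> H" for H
    proof -
      have add: "x + y \<in> H" if "x \<in> H" "y \<in> H" for x y
      proof -
        \<comment> \<open>\<open>y - y - y\<close> is \<open>- y\<close>, so closure under
          differences gives closure under sums.\<close>
        have "y - y - y \<in> H" using diff that by blast
        then have "x - (y - y - y) \<in> H" using diff that by blast
        then show ?thesis by simp
      qed
      have "X \<subseteq> H" using X(1) \<open>A \<subseteq> H\<close> by (auto simp: B_def set_plus_def intro: add)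
      then have D: "D \<subseteq> H" using diff by (auto simp: D_def set_plus_def)
      have "S h \<subseteq> H" for h
      proof (induction h)
        case (Suc h)
        have "S (Suc h) = A + S h" by (simp add: S_def)
        then show ?case using Suc \<open>A \<subseteq> H\<close> by (auto simp: set_plus_def intro: add)
      qed (use D in \<open>simp add: S_def\<close>)
      then show ?thesis .
    qed
    ultimately show "\<exists>S. finite S \<and> S \<noteq> {} \<and> real (card (S + (A + A))) \<le> (1 + \<epsilon>) * card S
      \<and> real (card S) \<le> (2 * real N + 1) ^ 17 * 6 * card (A + A)
      \<and> (\<forall>H. A \<subseteq> H \<longrightarrow> (\<forall>x\<in>H. \<forall>y\<in>H. x - y \<in> H) \<longrightarrow> S \<subseteq> H)"
      using j(2) finS S_step by (intro exI[of _ "S (2 * j)"]) auto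
  qed
qed

text \<open>The estimate \<open>key\<close> is added up for \<open>t = m + m\<close>,
  \<open>m + M\<close> and \<open>M + M\<close>. The three windows cover the whole triple sumset, so
  \<open>3 * card B + card T\<close> is at most \<open>3 * card T + 3\<close>.\<close>

lemma linordered_triple_sumset:
  fixes A :: "'a::linordered_ab_group_add set"
  assumes "finite A" "A \<noteq> {}"
  shows "3 * card (A + A) \<le> 2 * card (A + A + A) + 3"
proof -
  define m where "m = Min A"
  define M where "M = Max A"
  have m: "m \<in> A" "\<And>a. a \<in> A \<Longrightarrow> m \<le> a" and M: "M \<in> A" "\<And>a. a \<in> A \<Longrightarrow> a \<le> M"
    using assms by (auto simp: m_def M_def)
  define B where "B = A + A"
  define T where "T = B + A"
  have fin: "finite B" "finite T"
    unfolding T_def B_def using assms by (auto intro!: finite_set_plus)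
  have TI: "a + b \<in> T" if "a \<in> A" "b \<in> B" for a b
    unfolding T_def add.commute[of B A] using that by (rule set_plus_intro)
  \<comment> \<open>The part of \<open>B\<close> below \<open>t\<close> shifted by the minimum and the part above \<open>t\<close> shifted by
    the maximum leave the window from \<open>m + t\<close> to \<open>M + t\<close> free.\<close>
  have key: "card B + card (T \<inter> {m + t..M + t}) \<le> card T + 1" for t
  proof -
    define L where "L = (+) m ` (B \<inter> {..<t})"
    define R where "R = (+) M ` (B \<inter> {t<..})"
    have fLR: "finite L" "finite R" using fin by (auto simp: L_def R_def)
    have mM: "m \<le> M" using m M by auto
    have sub: "L \<union> R \<union> (T \<inter> {m + t..M + t}) \<subseteq> T"
      using m(1) M(1) TI by (auto simp: L_def R_def)
    have LR: "L \<inter> R = {}"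
    proof -
      have "m + x \<noteq> M + y" if "x < t" "t < y" for x y
        using add_le_less_mono[OF mM less_trans[OF that]] by auto
      then show ?thesis by (auto simp: L_def R_def)
    qed
    have "(L \<union> R) \<inter> (T \<inter> {m + t..M + t}) = {}"
      by (auto simp: L_def R_def)
    then have "card L + card R + card (T \<inter> {m + t..M + t}) = card (L \<union> R \<union> (T \<inter> {m + t..M + t}))"
      using fLR fin LR by (simp add: card_Un_disjoint)
    also have "\<dots> \<le> card T" using sub fin by (intro card_mono)
    finally have 1: "card L + card R + card (T \<inter> {m + t..M + t}) \<le> card T" .
    \<comment> \<open>The point \<open>t\<close> belongs to neither half; this is the loss of 1 per
      cut.\<close>
    have "B \<subseteq> (B \<inter> {..<t}) \<union> (B \<inter> {t<..}) \<union> {t}" by auto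
    then have "card B \<le> card ((B \<inter> {..<t}) \<union> (B \<inter> {t<..}) \<union> {t})"
      using fin by (intro card_mono) auto
    also have "\<dots> \<le> card (B \<inter> {..<t}) + card (B \<inter> {t<..}) + 1"
      using card_Un_le[of "(B \<inter> {..<t}) \<union> (B \<inter> {t<..})" "{t}"]
        card_Un_le[of "B \<inter> {..<t}" "B \<inter> {t<..}"] by simp
    also have "\<dots> = card L + card R + 1"
      by (simp add: L_def R_def card_image)
    finally show ?thesis using 1 by linarith
  qed
  have "T \<subseteq> (T \<inter> {m + (m + m)..M + (m + m)}) \<union> (T \<inter> {m + (m + M)..M + (m + M)})
      \<union> (T \<inter> {m + (M + M)..M + (M + M)})"
  proof
    fix x assume x: "x \<in> T"
    then obtain a b c where "x = a + b + c" "a \<in> A" "b \<in> A" "c \<in> A"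
      by (auto simp: T_def B_def set_plus_def)
    then have "m + (m + m) \<le> x" "x \<le> M + (M + M)"
      using add_mono[OF m(2)[of a] add_mono[OF m(2)[of b] m(2)[of c]]]
        add_mono[OF M(2)[of a] add_mono[OF M(2)[of b] M(2)[of c]]] by (simp_all add: add.assoc)
    \<comment> \<open>Each window ends where the next one begins.\<close>
    moreover have "M + (m + m) = m + (m + M)" "M + (m + M) = m + (M + M)"
      by (simp_all add: ac_simps)
    ultimately show "x \<in> (T \<inter> {m + (m + m)..M + (m + m)}) \<union> (T \<inter> {m + (m + M)..M + (m + M)})
      \<union> (T \<inter> {m + (M + M)..M + (M + M)})"
      using x linear[of x "m + (m + M)"] linear[of x "m + (M + M)"]
      by (simp only:) auto
  qed
  then have "card T \<le> card ((T \<inter> {m + (m + m)..M + (m + m)}) \<union> (T \<inter> {m + (m + M)..M + (m + M)})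
      \<union> (T \<inter> {m + (M + M)..M + (M + M)}))"
    using fin by (intro card_mono) auto
  also have "\<dots> \<le> card (T \<inter> {m + (m + m)..M + (m + m)}) + card (T \<inter> {m + (m + M)..M + (m + M)})
      + card (T \<inter> {m + (M + M)..M + (M + M)})"
    by (intro order_trans[OF card_Un_le] add_mono card_Un_le order_refl)
  finally show ?thesis
    using key[of "m + m"] key[of "m + M"] key[of "M + M"] by (simp add: T_def B_def)
qed

section \<open>Fourier analysis on torsion points of the circle\<close>

text \<open>The standard character of the circle. It is injective, so
  \<open>circle_cis g ^ n = 1\<close> expresses that \<open>g\<close> is an \<open>n\<close>-torsion
  point.\<close>

lift_definition circle_cis :: "circle \<Rightarrow> complex" is "\<lambda>x. cis (2 * pi * x)"
proof -
  fix x y :: real assume "x - y \<in> \<int>"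
  then have "cis (2 * pi * (x - y)) = 1" by (rule cis_multiple_2pi)
  moreover have "cis (2 * pi * x) = cis (2 * pi * (x - y)) * cis (2 * pi * y)"
    by (simp add: cis_mult algebra_simps)
  ultimately show "cis (2 * pi * x) = cis (2 * pi * y)" by simp
qed

lemma circle_cis_add: "circle_cis (x + y) = circle_cis x * circle_cis y"
  by transfer (simp add: cis_mult algebra_simps)

lemma circle_cis_diff: "circle_cis (x - y) = circle_cis x * cnj (circle_cis y)"
  by transfer (simp add: cis_mult cis_cnj algebra_simps)

lemma norm_circle_cis [simp]: "norm (circle_cis x) = 1"
  by transfer simp

lemma circle_cis_eq_1_iff: "circle_cis x = 1 \<longleftrightarrow> x = 0"
proof
  assume "circle_cis x = 1"
  then show "x = 0"
  proof transfer
    fix x :: real assume "cis (2 * pi * x) = 1"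
    then have "cos (2 * pi * x) = 1" by (metis cis.sel(1) one_complex.sel(1))
    then obtain n :: int where "2 * pi * x = of_int n * 2 * pi"
      by (auto simp: cos_one_2pi_int)
    then have "x = of_int n" by simp
    then show "x - 0 \<in> \<int>" by simp
  qed
next
  assume "x = 0" then show "circle_cis x = 1" by simp (transfer, simp)
qed

text \<open>Orthogonality of characters on the \<open>p\<close>-torsion group, as a geometric sum
  whose ratio is 1 only at \<open>t = 0\<close>.\<close>

lemma sum_circle_cis_powers:
  assumes "circle_cis t ^ p = 1"
  shows "(\<Sum>r<p. circle_cis t ^ r) = (if t = 0 then of_nat p else 0)"
  using assms geometric_sum[of "circle_cis t" p] circle_cis_eq_1_iff[of t] by auto

definition fourier_coeff :: "nat \<Rightarrow> circle set \<Rightarrow> complex" where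
  "fourier_coeff r S = (\<Sum>x\<in>S. circle_cis x ^ r)"

lemma norm_fourier_coeff_squared:
  "complex_of_real ((norm (fourier_coeff r S))\<^sup>2) = (\<Sum>x\<in>S. \<Sum>y\<in>S. circle_cis (x - y) ^ r)"
  unfolding complex_norm_square
  by (simp add: fourier_coeff_def sum_product circle_cis_diff power_mult_distrib)

lemma torsion_diff:
  assumes "circle_cis x ^ p = 1" "circle_cis y ^ p = 1"
  shows "circle_cis (x - y) ^ p = 1"
  using assms by (simp add: circle_cis_diff power_mult_distrib flip: complex_cnj_power)

lemma torsion_add:
  assumes "circle_cis x ^ p = 1" "circle_cis y ^ p = 1"
  shows "circle_cis (x + y) ^ p = 1"
  using assms by (simp add: circle_cis_add power_mult_distrib)

text \<open>After expanding the squares and summing over \<open>r\<close> first, orthogonality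
  leaves only the diagonal \<open>x = y\<close>.\<close>

lemma fourier_parseval:
  assumes "finite S" "\<And>x. x \<in> S \<Longrightarrow> circle_cis x ^ p = 1"
  shows "(\<Sum>r<p. (norm (fourier_coeff r S))\<^sup>2) = real p * card S"
proof -
  have "complex_of_real (\<Sum>r<p. (norm (fourier_coeff r S))\<^sup>2)
      = (\<Sum>r<p. \<Sum>x\<in>S. \<Sum>y\<in>S. circle_cis (x - y) ^ r)"
    by (simp only: of_real_sum norm_fourier_coeff_squared)
  also have "\<dots> = (\<Sum>x\<in>S. \<Sum>y\<in>S. \<Sum>r<p. circle_cis (x - y) ^ r)"
    by ((subst sum.swap, rule sum.cong[OF refl])+, rule refl)
  also have "\<dots> = (\<Sum>x\<in>S. \<Sum>y\<in>S. if x = y then of_nat p else 0)"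
    using assms(2) by (intro sum.cong refl) (simp add: sum_circle_cis_powers torsion_diff)
  also have "\<dots> = of_real (real p * card S)"
    using assms(1) by simp
  finally show ?thesis using of_real_eq_iff by blast
qed

text \<open>Both sides are \<open>p\<close> times the additive energy, the number of quadruples with
  \<open>s + b = s' + b'\<close>; orthogonality picks these out of the expanded product.\<close>

lemma fourier_energy:
  assumes "finite S" "\<And>x. x \<in> S \<Longrightarrow> circle_cis x ^ p = 1"
    and "finite B" "\<And>x. x \<in> B \<Longrightarrow> circle_cis x ^ p = 1"
  shows "(\<Sum>r<p. (norm (fourier_coeff r S))\<^sup>2 * (norm (fourier_coeff r B))\<^sup>2)
    = real p * (\<Sum>b\<in>B. \<Sum>b'\<in>B. real (card {s \<in> S. s + b - b' \<in> S}))"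
proof -
  have "complex_of_real (\<Sum>r<p. (norm (fourier_coeff r S))\<^sup>2 * (norm (fourier_coeff r B))\<^sup>2)
      = (\<Sum>r<p. (\<Sum>b\<in>B. \<Sum>b'\<in>B. circle_cis (b - b') ^ r) * (\<Sum>s\<in>S. \<Sum>s'\<in>S. circle_cis (s - s') ^ r))"
    by (simp only: of_real_sum of_real_mult norm_fourier_coeff_squared mult.commute)
  also have "\<dots> = (\<Sum>r<p. \<Sum>b\<in>B. \<Sum>b'\<in>B. \<Sum>s\<in>S. \<Sum>s'\<in>S. circle_cis (s + b - b' - s') ^ r)"
  proof -
    have "circle_cis (b - b') ^ r * circle_cis (s - s') ^ r = circle_cis (s + b - b' - s') ^ r"
      for b b' s s' r
      by (simp add: algebra_simps flip: power_mult_distrib circle_cis_add)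
    then show ?thesis by (simp only: sum_distrib_right) (simp only: sum_distrib_left)
  qed
  also have "\<dots> = (\<Sum>b\<in>B. \<Sum>b'\<in>B. \<Sum>s\<in>S. \<Sum>s'\<in>S. \<Sum>r<p. circle_cis (s + b - b' - s') ^ r)"
    by ((subst sum.swap, rule sum.cong[OF refl])+, rule refl)
  also have "\<dots> = (\<Sum>b\<in>B. \<Sum>b'\<in>B. \<Sum>s\<in>S. \<Sum>s'\<in>S. if s + b - b' = s' then of_nat p else 0)"
    using assms by (intro sum.cong refl) (simp add: sum_circle_cis_powers torsion_diff torsion_add)
  also have "\<dots> = (\<Sum>b\<in>B. \<Sum>b'\<in>B. of_nat p * of_nat (card {s \<in> S. s + b - b' \<in> S}))"
    using assms(1) by (simp add: sum.If_cases Int_def mult.commute)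
  also have "\<dots> = of_real (real p * (\<Sum>b\<in>B. \<Sum>b'\<in>B. real (card {s \<in> S. s + b - b' \<in> S})))"
    by (simp add: sum_distrib_left)
  finally show ?thesis using of_real_eq_iff by blast
qed

text \<open>The translates \<open>b + S\<close> and \<open>b' + S\<close> both lie in
  \<open>S + B\<close>, so inclusion-exclusion bounds their intersection from below. Shifting by
  \<open>b\<close> identifies it with the set counted here.\<close>

lemma card_overlap_ge:
  fixes S B :: "'a::ab_group_add set"
  assumes "finite S" "finite B" "b \<in> B" "b' \<in> B"
  shows "2 * card S \<le> card {s \<in> S. s + b - b' \<in> S} + card (S + B)"
proof -
  have eq: "(+) b ` {s \<in> S. s + b - b' \<in> S} = (+) b ` S \<inter> (+) b' ` S"
  proof (intro equalityI subsetI)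
    fix x assume "x \<in> (+) b ` S \<inter> (+) b' ` S"
    then obtain s s' where "s \<in> S" "s' \<in> S" "x = b + s" "x = b' + s'" by auto
    moreover from this have "s + b - b' = s'" by (metis add.commute add_diff_cancel_left')
    ultimately show "x \<in> (+) b ` {s \<in> S. s + b - b' \<in> S}" by auto
  next
    fix x assume "x \<in> (+) b ` {s \<in> S. s + b - b' \<in> S}"
    then obtain s where "s \<in> S" "s + b - b' \<in> S" "x = b + s" by auto
    moreover have "b + s = b' + (s + b - b')" by simp
    ultimately show "x \<in> (+) b ` S \<inter> (+) b' ` S" by blast
  qed
  have "card ((+) b ` S \<union> (+) b' ` S) \<le> card (B + S)"
    using assms by (intro card_mono finite_set_plus) auto
  moreover have "card ((+) b ` S) + card ((+) b' ` S)
      = card ((+) b ` S \<union> (+) b' ` S) + card ((+) b ` S \<inter> (+) b' ` S)"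
    using assms by (intro card_Un_Int) auto
  ultimately show ?thesis by (simp add: card_translate add.commute[of S B] flip: eq)
qed

text \<open>Almost invariance makes the energy of \<open>S\<close> and \<open>B\<close> at least
  \<open>(1 - \<epsilon>) * card S * (card B)^2\<close>. The trivial character supplies only
  \<open>(card S)^2 * (card B)^2\<close>, and Parseval limits the weight of the other ones, so one
  of their coefficients on \<open>B\<close> must be large.\<close>

lemma exists_large_fourier_coeff:
  fixes \<epsilon> \<eta> :: real
  assumes S: "finite S" "S \<noteq> {}" "\<And>x. x \<in> S \<Longrightarrow> circle_cis x ^ p = 1"
    and B: "finite B" "B \<noteq> {}" "\<And>x. x \<in> B \<Longrightarrow> circle_cis x ^ p = 1"
    and inv: "real (card (S + B)) \<le> (1 + \<epsilon>) * card S"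
    and small: "real (card S) \<le> \<eta> * p" and pos: "\<epsilon> + \<eta> < 1" and "p > 0"
  shows "\<exists>r. 0 < r \<and> r < p \<and> (1 - \<epsilon> - \<eta>) * (card B)\<^sup>2 \<le> (norm (fourier_coeff r B))\<^sup>2"
proof (rule ccontr)
  assume neg: "\<not> ?thesis"
  have lt: "(norm (fourier_coeff r B))\<^sup>2 \<le> (1 - \<epsilon> - \<eta>) * (card B)\<^sup>2" if "r \<in> {..<p} - {0}" for r
  proof -
    have "0 < r" "r < p" using that by auto
    then moreover have "\<forall>r. \<not> (0 < r \<and> r < p \<and> (1 - \<epsilon> - \<eta>) * (card B)\<^sup>2 \<le> (norm (fourier_coeff r B))\<^sup>2)"
      using neg by blast
    ultimately have "\<not> ((1 - \<epsilon> - \<eta>) * (card B)\<^sup>2 \<le> (norm (fourier_coeff r B))\<^sup>2)"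
      by blast
    then show ?thesis by linarith
  qed
  define b s where "b = real (card B)" and "s = real (card S)"
  have bs: "b > 0" "s > 0" using S B by (auto simp: b_def s_def card_gt_0_iff)
  have c0: "(norm (fourier_coeff 0 X))\<^sup>2 = (real (card X))\<^sup>2" for X by (simp add: fourier_coeff_def)
  have "b * b * ((1 - \<epsilon>) * s) = (\<Sum>x\<in>B. \<Sum>y\<in>B. (1 - \<epsilon>) * s)"
    by (simp add: b_def)
  also have "\<dots> \<le> (\<Sum>x\<in>B. \<Sum>y\<in>B. real (card {s \<in> S. s + x - y \<in> S}))"
  proof (intro sum_mono)
    fix x y :: circle assume "x \<in> B" "y \<in> B"
    then have "2 * card S \<le> card {s \<in> S. s + x - y \<in> S} + card (S + B)"
      using S B by (intro card_overlap_ge)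
    then have "2 * s \<le> card {s \<in> S. s + x - y \<in> S} + (1 + \<epsilon>) * s"
      using inv unfolding s_def by linarith
    then show "(1 - \<epsilon>) * s \<le> card {s \<in> S. s + x - y \<in> S}" by (simp add: algebra_simps)
  qed
  finally have "p * (b * b * ((1 - \<epsilon>) * s))
      \<le> p * (\<Sum>x\<in>B. \<Sum>y\<in>B. real (card {s \<in> S. s + x - y \<in> S}))"
    by (intro mult_left_mono) auto
  also have "\<dots> = (\<Sum>r<p. (norm (fourier_coeff r S))\<^sup>2 * (norm (fourier_coeff r B))\<^sup>2)"
    using S B by (intro fourier_energy[symmetric]) auto
  also have "\<dots> = s\<^sup>2 * b\<^sup>2 + (\<Sum>r\<in>{..<p} - {0}. (norm (fourier_coeff r S))\<^sup>2 * (norm (fourier_coeff r B))\<^sup>2)"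
    using \<open>p > 0\<close> by (subst sum.remove[of _ 0]) (auto simp: c0 s_def b_def)
  also have "\<dots> \<le> s\<^sup>2 * b\<^sup>2 + (\<Sum>r\<in>{..<p} - {0}. (norm (fourier_coeff r S))\<^sup>2 * ((1 - \<epsilon> - \<eta>) * b\<^sup>2))"
    using lt by (intro add_left_mono sum_mono mult_left_mono) (auto simp: b_def)
  also have "\<dots> = s\<^sup>2 * b\<^sup>2 + (\<Sum>r\<in>{..<p} - {0}. (norm (fourier_coeff r S))\<^sup>2) * ((1 - \<epsilon> - \<eta>) * b\<^sup>2)"
    by (simp add: sum_distrib_right)
  also have "(\<Sum>r\<in>{..<p} - {0}. (norm (fourier_coeff r S))\<^sup>2) = p * s - s\<^sup>2"
    using fourier_parseval[of S p] S \<open>p > 0\<close> sum.remove[of "{..<p}" 0 "\<lambda>r. (norm (fourier_coeff r S))\<^sup>2"]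
    by (simp add: c0 s_def)
  finally have "b\<^sup>2 * (s * (p * (1 - \<epsilon>))) \<le> b\<^sup>2 * (s * (s + (p - s) * (1 - \<epsilon> - \<eta>)))"
    by (simp add: algebra_simps power2_eq_square)
  \<comment> \<open>Strictness comes from \<open>s > 0\<close> and
    \<open>1 - \<epsilon> - \<eta> > 0\<close>: the weight left for nontrivial characters is
    \<open>p - s\<close>, not \<open>p\<close>.\<close>
  then have "p * (1 - \<epsilon>) \<le> s + (p - s) * (1 - \<epsilon> - \<eta>)"
    using bs by (simp only: mult_le_cancel_left_pos zero_less_power)
  also have "\<dots> \<le> \<eta> * p + (p - s) * (1 - \<epsilon> - \<eta>)" using small by (simp add: s_def)
  also have "\<dots> < \<eta> * p + p * (1 - \<epsilon> - \<eta>)"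
    using bs pos by (intro add_strict_left_mono mult_strict_right_mono) auto
  finally show False by (simp add: algebra_simps)
qed

section \<open>Rectification\<close>

lemma norm_circle_cis_power [simp]: "norm (circle_cis x ^ r) = 1"
  by (simp add: norm_power)

text \<open>Both arguments have modulus below \<open>pi / 6\<close>, so they differ by less than
  \<open>pi / 3\<close>. In coordinates, \<open>64/81 - 17/81 > 1/2\<close>.\<close>

lemma Re_mult_cnj_gt_half:
  assumes "norm u = 1" "norm v = 1" "Re u > 8/9" "Re v > 8/9"
  shows "Re (u * cnj v) > 1/2"
proof -
  have im: "(Im z)\<^sup>2 \<le> 17/81" if "norm z = 1" "Re z > 8/9" for z
  proof -
    have "(Re z)\<^sup>2 + (Im z)\<^sup>2 = 1" using that(1) by (metis cmod_power2 one_power2)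
    moreover have "(8/9)\<^sup>2 \<le> (Re z)\<^sup>2" using that(2) by (intro power_mono) auto
    ultimately show ?thesis by (simp add: power2_eq_square)
  qed
  have "- (2 * (Im u * Im v)) \<le> (Im u)\<^sup>2 + (Im v)\<^sup>2"
    using zero_le_power2[of "Im u + Im v"] by (simp add: power2_sum)
  then have "Im u * Im v \<ge> - 17/81" using im[OF assms(1,3)] im[OF assms(2,4)] by linarith
  moreover have "Re u * Re v > 8/9 * (8/9)"
    using assms by (intro mult_strict_mono) auto
  ultimately show ?thesis by simp
qed

text \<open>Markov's inequality for the deficits \<open>1 - h b\<close>: their average is at most
  1/40 and each exceptional one is at least 1/9, so the exceptional proportion is at most 9/40,
  below 1/4.\<close>

lemma few_exceptional_phases:
  assumes "finite B" "B \<noteq> {}" and large: "39/40 * card B \<le> norm (fourier_coeff r B)"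
  obtains T where "T \<subseteq> B" "4 * card T < card B"
    "\<And>b b'. b \<in> B - T \<Longrightarrow> b' \<in> B - T \<Longrightarrow> Re (circle_cis (b' - b) ^ r) > 1/2"
proof -
  define z where "z = fourier_coeff r B"
  \<comment> \<open>Multiplication by \<open>w\<close> rotates the coefficient onto the positive
    real axis.\<close>
  define w where "w = cnj (sgn z)"
  define h where "h b = Re (w * circle_cis b ^ r)" for b
  define T where "T = {b \<in> B. h b \<le> 8/9}"
  have B: "card B > 0" using assms by (simp add: card_gt_0_iff)
  then have "norm z > 0" using large by (auto simp: z_def intro: less_le_trans[rotated])
  then have w: "norm w = 1" by (simp add: w_def norm_sgn)
  have le1: "h b \<le> 1" for b
    using complex_Re_le_cmod[of "w * circle_cis b ^ r"] by (simp add: h_def norm_mult w)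
  have "(\<Sum>b\<in>B. h b) = Re (w * z)"
    by (simp add: h_def z_def fourier_coeff_def sum_distrib_left)
  also have "w * z = of_real (norm z)"
  proof -
    have "w * z = z * cnj z / of_real (norm z)" by (simp add: w_def sgn_eq)
    also have "\<dots> = of_real (norm z)"
      unfolding complex_norm_square[symmetric] using \<open>norm z > 0\<close> by (simp add: power2_eq_square)
    finally show ?thesis .
  qed
  finally have sum: "(\<Sum>b\<in>B. 1 - h b) = card B - norm z"
    by (simp add: sum_subtractf)
  have "real (card T) * (1/9) = (\<Sum>b\<in>T. 1/9)" by simp
  also have "\<dots> \<le> (\<Sum>b\<in>T. 1 - h b)" by (intro sum_mono) (auto simp: T_def)
  also have "\<dots> \<le> (\<Sum>b\<in>B. 1 - h b)"
    using assms(1) le1 by (intro sum_mono2) (auto simp: T_def)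
  also have "\<dots> \<le> card B / 40" using sum large by (simp add: z_def)
  finally have "real (4 * card T) < real (card B)" using B by simp
  then have "4 * card T < card B" by linarith
  moreover have "T \<subseteq> B" by (auto simp: T_def)
  moreover have "Re (circle_cis (b' - b) ^ r) > 1/2" if "b \<in> B - T" "b' \<in> B - T" for b b'
  proof -
    have "Re ((w * circle_cis b' ^ r) * cnj (w * circle_cis b ^ r)) > 1/2"
      using that by (intro Re_mult_cnj_gt_half) (auto simp: norm_mult w T_def h_def)
    also have "(w * circle_cis b' ^ r) * cnj (w * circle_cis b ^ r)
        = (w * cnj w) * (circle_cis b' * cnj (circle_cis b)) ^ r"
      by (simp add: power_mult_distrib)
    also have "w * cnj w = 1" using w by (simp add: complex_norm_square[symmetric])
    finally show ?thesis by (simp add: circle_cis_diff)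
  qed
  ultimately show ?thesis using that by blast
qed

text \<open>Disjoint translates of \<open>B - T\<close> by \<open>a\<close> and \<open>a'\<close>
  would give \<open>A + B\<close> more than \<open>3/2 * card B\<close> points. A common point
  writes \<open>a - a'\<close> as a difference of two unexceptional elements of
  \<open>B\<close>.\<close>

lemma phases_close_of_small_tripling:
  fixes A :: "circle set"
  defines "B \<equiv> A + A"
  assumes "finite A" and small: "2 * card (A + B) \<le> 3 * card B"
    and large: "39/40 * card B \<le> norm (fourier_coeff r B)"
    and a: "a \<in> A" "a' \<in> A"
  shows "Re (circle_cis (a - a') ^ r) > 1/2"
proof -
  have B: "finite B" "B \<noteq> {}"
    using assms(2) a by (auto simp: B_def intro!: finite_set_plus)
  obtain T where T: "T \<subseteq> B" "4 * card T < card B"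
    and close: "\<And>b b'. b \<in> B - T \<Longrightarrow> b' \<in> B - T \<Longrightarrow> Re (circle_cis (b' - b) ^ r) > 1/2"
    using few_exceptional_phases[OF B large] by metis
  have "(+) a ` (B - T) \<inter> (+) a' ` (B - T) \<noteq> {}"
  proof
    assume disj: "(+) a ` (B - T) \<inter> (+) a' ` (B - T) = {}"
    have finT: "finite T" using T(1) B(1) finite_subset by auto
    have "card (B - T) + card (B - T) = card ((+) a ` (B - T) \<union> (+) a' ` (B - T))"
      using disj B(1) by (simp add: card_Un_disjoint card_translate)
    also have "\<dots> \<le> card (A + B)"
      using a assms(2) B(1) by (intro card_mono finite_set_plus) (auto intro!: set_plus_intro)
    finally have "2 * card (B - T) \<le> card (A + B)" by simp
    moreover have "card (B - T) = card B - card T" using T(1) finT by (simp add: card_Diff_subset)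
    ultimately show False using small T(2) by linarith
  qed
  then obtain b b' where b: "b \<in> B - T" "b' \<in> B - T" "a + b = a' + b'" by blast
  then have "a - a' = b' - b" by (metis add.commute add_diff_cancel_left' diff_diff_eq2 diff_add_eq)
  then show ?thesis using close[OF b(1,2)] by simp
qed

lemma abs_Arg_less_pi_third:
  assumes "norm z = 1" "Re z > 1/2"
  shows "\<bar>Arg z\<bar> < pi / 3"
proof (rule ccontr)
  assume "\<not> ?thesis"
  then have "cos \<bar>Arg z\<bar> \<le> cos (pi / 3)"
    using Arg_bounded[of z] by (intro cos_monotone_0_pi_le) auto
  moreover have "cos \<bar>Arg z\<bar> = Re z"
  proof -
    have "z \<noteq> 0" using assms by auto
    then have "Re (cis (Arg z)) = Re z" using assms(1) by (simp add: cis_Arg sgn_eq)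
    then show ?thesis by simp
  qed
  ultimately show False using assms(2) by (simp add: cos_60)
qed

text \<open>\<open>r\<close> is invertible modulo \<open>p\<close>, so by Bezout a point killed by
  both \<open>r\<close> and \<open>p\<close> is zero.\<close>

lemma torsion_prime_power_eq_1:
  assumes "prime p" "0 < r" "r < p" "circle_cis x ^ p = 1" "circle_cis x ^ r = 1"
  shows "x = 0"
proof -
  have "coprime r p"
    using assms by (metis coprime_commute nat_dvd_not_less prime_imp_coprime)
  then obtain u v where "r * u = p * v + 1"
    using bezout_nat[of r p] assms(2) by (metis coprime_imp_gcd_eq_1 neq0_conv)
  then have "circle_cis x ^ (r * u) = circle_cis x ^ (p * v) * circle_cis x"
    by simp
  then have "circle_cis x = 1" using assms(4,5) by (simp add: power_mult)
  then show ?thesis by (simp add: circle_cis_eq_1_iff)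
qed

text \<open>After translating \<open>A\<close> by \<open>- a0\<close>, all arguments are below
  \<open>pi / 3\<close> in modulus. Sums of up to three then stay inside \<open>(-pi, pi)\<close>,
  where \<open>Arg\<close> is additive, and the bound for ordered groups applies to the image in the
  reals.\<close>

lemma torsion_tripling_of_close_phases:
  assumes p: "prime p" "0 < r" "r < p"
    and A: "finite A" "A \<noteq> {}" "\<And>a. a \<in> A \<Longrightarrow> circle_cis a ^ p = 1"
    and close: "\<And>a a'. a \<in> A \<Longrightarrow> a' \<in> A \<Longrightarrow> Re (circle_cis (a - a') ^ r) > 1/2"
  shows "3 * card (A + A) \<le> 2 * card (A + A + A) + 3"
proof -
  obtain a0 where a0: "a0 \<in> A" using A by auto
  define A0 where "A0 = (+) (- a0) ` A"
  define L where "L x = Arg (circle_cis x ^ r)" for x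
  have A0_tors: "circle_cis a ^ p = 1" if "a \<in> A0" for a
    using that torsion_diff[of _ p a0] A(3) a0 by (auto simp: A0_def)
  have L_bound: "\<bar>L a\<bar> < pi / 3" if "a \<in> A0" for a
    unfolding L_def using that close a0 by (intro abs_Arg_less_pi_third) (auto simp: A0_def)
  have cis_L: "cis (L x) = circle_cis x ^ r" for x
  proof -
    have "circle_cis x ^ r \<noteq> 0" using norm_circle_cis_power[of x r] by (metis norm_zero zero_neq_one)
    then show ?thesis by (simp add: L_def cis_Arg sgn_eq)
  qed
  have L_eqI: "L x = t" if "circle_cis x ^ r = cis t" "\<bar>t\<bar> < pi" for x t
    unfolding L_def that(1) using that(2) by (intro Arg_cis) auto
  have L2: "L (a + b) = L a + L b" if "a \<in> A0" "b \<in> A0" for a b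
    using L_bound[OF that(1)] L_bound[OF that(2)]
    by (intro L_eqI) (auto simp: circle_cis_add power_mult_distrib cis_mult[symmetric] cis_L)
  have L3: "L (a + b + c) = L a + L b + L c" if "a \<in> A0" "b \<in> A0" "c \<in> A0" for a b c
    using L_bound[OF that(1)] L_bound[OF that(2)] L_bound[OF that(3)]
    by (intro L_eqI) (auto simp: circle_cis_add power_mult_distrib cis_mult[symmetric] cis_L)
  \<comment> \<open>Injectivity is proved on the whole torsion group so that it covers the double
    and triple sumsets too.\<close>
  have inj: "inj_on L {x. circle_cis x ^ p = 1}"
  proof (rule inj_onI, clarify)
    fix x y assume xy: "circle_cis x ^ p = 1" "circle_cis y ^ p = 1" "L x = L y"
    have "circle_cis x ^ r = circle_cis y ^ r" using xy(3) cis_L by metis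
    then have "circle_cis (x - y) ^ r = 1"
      by (simp add: circle_cis_diff power_mult_distrib complex_cnj_power[symmetric]
          complex_norm_square[symmetric] del: complex_cnj_power)
    then have "x - y = 0" using torsion_prime_power_eq_1[OF p] torsion_diff xy(1,2) by blast
    then show "x = y" by simp
  qed
  have im2: "L ` (A0 + A0) = L ` A0 + L ` A0"
    by (auto simp: set_plus_def image_iff) (metis L2)+
  have im3: "L ` (A0 + A0 + A0) = L ` A0 + L ` A0 + L ` A0"
    by (auto simp: set_plus_def image_iff) (metis L3)+
  have tors2: "A0 + A0 \<subseteq> {x. circle_cis x ^ p = 1}"
    by (auto simp: set_plus_def A0_tors torsion_add)
  have tors3: "A0 + A0 + A0 \<subseteq> {x. circle_cis x ^ p = 1}"
    by (auto simp: set_plus_def A0_tors torsion_add)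
  have c2: "card (L ` A0 + L ` A0) = card (A0 + A0)"
    unfolding im2[symmetric] using inj_on_subset[OF inj tors2] by (rule card_image)
  have c3: "card (L ` A0 + L ` A0 + L ` A0) = card (A0 + A0 + A0)"
    unfolding im3[symmetric] using inj_on_subset[OF inj tors3] by (rule card_image)
  have t: "(+) c ` X + (+) d ` Y = (+) (c + d) ` (X + Y)" for c d and X Y :: "circle set"
  proof (intro equalityI subsetI)
    fix t assume "t \<in> (+) c ` X + (+) d ` Y"
    then obtain x y where "x \<in> X" "y \<in> Y" "t = (c + x) + (d + y)" by (auto simp: set_plus_def)
    moreover from this have "t = (c + d) + (x + y)" by (simp add: ac_simps)
    ultimately show "t \<in> (+) (c + d) ` (X + Y)" by blast
  next
    fix t assume "t \<in> (+) (c + d) ` (X + Y)"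
    then obtain x y where "x \<in> X" "y \<in> Y" "t = (c + d) + (x + y)" by (auto simp: set_plus_def)
    moreover from this have "t = (c + x) + (d + y)" by (simp add: ac_simps)
    ultimately show "t \<in> (+) c ` X + (+) d ` Y" by (metis set_plus_intro imageI)
  qed
  have cA: "card (A0 + A0) = card (A + A)" "card (A0 + A0 + A0) = card (A + A + A)"
    unfolding A0_def t by (simp_all only: card_translate)
  have "finite (L ` A0)" "L ` A0 \<noteq> {}" using A by (auto simp: A0_def)
  from linordered_triple_sumset[OF this] show ?thesis unfolding c2 c3 cA .
qed

theorem torsion_tripling:
  "\<exists>c>0. \<forall>p A. prime p \<longrightarrow> finite A \<longrightarrow> A \<noteq> {} \<longrightarrow> (\<forall>a\<in>A. circle_cis a ^ p = 1) \<longrightarrow>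
    real (card (A + A)) \<le> c * real p \<longrightarrow> 3 * card (A + A) \<le> 2 * card (A + A + A) + 3"
proof -
  obtain C :: real where C: "C > 0" and almost_inv: "\<And>A :: circle set. finite A \<Longrightarrow> A \<noteq> {} \<Longrightarrow>
      2 * card (A + A + A) \<le> 3 * card (A + A) \<Longrightarrow>
      \<exists>S. finite S \<and> S \<noteq> {} \<and> real (card (S + (A + A))) \<le> (1 + 1/50) * card S
        \<and> real (card S) \<le> C * card (A + A)
        \<and> (\<forall>H. A \<subseteq> H \<longrightarrow> (\<forall>x\<in>H. \<forall>y\<in>H. x - y \<in> H) \<longrightarrow> S \<subseteq> H)"
    using exists_almost_invariant_set[of "1/50", where 'a = circle] by auto
  show ?thesis
  \<comment> \<open>This density turns \<open>card S \<le> C * card B\<close> into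
    \<open>card S \<le> p / 50\<close>, so both \<open>\<epsilon>\<close> and \<open>\<eta>\<close>
    are 1/50 in the Fourier step.\<close>
  proof (intro exI[of _ "1 / (50 * C)"] conjI allI impI)
    fix p and A :: "circle set"
    assume p: "prime p" and A: "finite A" "A \<noteq> {}" and tors: "\<forall>a\<in>A. circle_cis a ^ p = 1"
      and small: "real (card (A + A)) \<le> 1 / (50 * C) * real p"
    show "3 * card (A + A) \<le> 2 * card (A + A + A) + 3"
    proof (rule ccontr)
      assume contra: "\<not> ?thesis"
      then have tripling: "2 * card (A + A + A) \<le> 3 * card (A + A)" by simp
      define B where "B = A + A"
      have B: "finite B" "B \<noteq> {}"
        using A card_set_plus_pos[of A A] by (auto simp: B_def card_gt_0_iff)
      have Btors: "circle_cis b ^ p = 1" if "b \<in> B" for b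
        using that tors by (auto simp: B_def set_plus_def torsion_add)
      obtain S where S: "finite S" "S \<noteq> {}" "real (card (S + B)) \<le> (1 + 1/50) * card S"
          "real (card S) \<le> C * card B"
        and S_gen: "\<And>H. A \<subseteq> H \<Longrightarrow> \<forall>x\<in>H. \<forall>y\<in>H. x - y \<in> H \<Longrightarrow> S \<subseteq> H"
        using almost_inv[OF A tripling] unfolding B_def by auto
      have "S \<subseteq> {x. circle_cis x ^ p = 1}"
        using tors by (intro S_gen) (auto simp: torsion_diff)
      then have Stors: "circle_cis x ^ p = 1" if "x \<in> S" for x using that by auto
      have "real (card S) \<le> C * (1 / (50 * C) * p)"
        using S(4) mult_left_mono[OF small, of C] C unfolding B_def by simp
      then have "real (card S) \<le> 1/50 * p" using C by simp
      then obtain r where r: "0 < r" "r < p"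
        and large: "(1 - 1/50 - 1/50) * (real (card B))\<^sup>2 \<le> (norm (fourier_coeff r B))\<^sup>2"
        using exists_large_fourier_coeff[OF S(1,2) Stors B Btors S(3), of "1/50"] prime_gt_0_nat[OF p]
        by auto
      \<comment> \<open>The guaranteed fraction 24/25 of \<open>(card B)^2\<close> exceeds the
        square of 39/40.\<close>
      have "(39/40 * real (card B))\<^sup>2 = 1521/1600 * (real (card B))\<^sup>2"
        by (simp add: power_mult_distrib power2_eq_square)
      also have "\<dots> \<le> (1 - 1/50 - 1/50) * (real (card B))\<^sup>2"
        by (intro mult_right_mono) auto
      also note large
      finally have "(39/40 * real (card B))\<^sup>2 \<le> (norm (fourier_coeff r B))\<^sup>2" .
      then have "39/40 * real (card B) \<le> norm (fourier_coeff r B)"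
        by (rule power2_le_imp_le) simp
      moreover have "2 * card (A + B) \<le> 3 * card B"
        using tripling by (simp add: B_def add.assoc)
      ultimately have "Re (circle_cis (a - a') ^ r) > 1/2" if "a \<in> A" "a' \<in> A" for a a'
        using phases_close_of_small_tripling[OF A(1)] that unfolding B_def by blast
      then show False
        using torsion_tripling_of_close_phases[OF p r A] tors contra by blast
    qed
  qed (use C in auto)
qed

section \<open>Discretisation of closed sets\<close>

lemma to_circle_diff: "to_circle (x - y) = to_circle x - to_circle y"
  by (simp add: minus_circle.abs_eq)

lemma closed_circle_iff: "closed A \<longleftrightarrow> closed (to_circle -` A)"
  by (simp add: closed_def open_circle_def vimage_Compl)

text \<open>Lifts a sumset to the real line, where closed plus compact is closed.\<close>

lemma vimage_to_circle_add:
  "to_circle -` (A + to_circle ` K) = (to_circle -` A) + K"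
proof (intro equalityI subsetI)
  fix x assume "x \<in> to_circle -` (A + to_circle ` K)"
  then obtain a k where "a \<in> A" "k \<in> K" "to_circle x = a + to_circle k"
    by (auto simp: set_plus_def)
  then have "to_circle (x - k) = a"
    by (metis add_diff_cancel_right' diff_conv_add_uminus to_circle_add to_circle_minus)
  then have "(x - k) + k \<in> (to_circle -` A) + K"
    using \<open>a \<in> A\<close> \<open>k \<in> K\<close> by (intro set_plus_intro) auto
  then show "x \<in> (to_circle -` A) + K" by simp
next
  fix x assume "x \<in> (to_circle -` A) + K"
  then obtain a k where "to_circle a \<in> A" "k \<in> K" "x = a + k"
    by (auto simp: set_plus_def)
  then show "x \<in> to_circle -` (A + to_circle ` K)"
    by (auto simp: to_circle_add intro!: set_plus_intro)
qed


lemma image_to_circle_fundamental: "to_circle ` (to_circle -` A \<inter> {0..1}) = A"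
proof (intro equalityI subsetI)
  fix a assume "a \<in> A"
  obtain x where x: "a = to_circle x" by (rule to_circle_cases)
  have "to_circle (frac x) = a"
    unfolding x by (simp add: to_circle_eq_iff frac_def)
  then show "a \<in> to_circle ` (to_circle -` A \<inter> {0..1})"
    using \<open>a \<in> A\<close> frac_ge_0[of x] frac_lt_1[of x] by (intro image_eqI[of _ _ "frac x"]) auto
qed auto

lemma closed_plus_image_compact:
  assumes "closed A" "compact K"
  shows "closed (A + to_circle ` K)"
proof -
  have "closed (\<Union>x\<in>to_circle -` A. \<Union>y\<in>K. {x + y})"
    using assms closed_circle_iff by (intro closed_compact_sums) auto
  moreover have "(\<Union>x\<in>to_circle -` A. \<Union>y\<in>K. {x + y}) = to_circle -` A + K"
    by (auto simp: set_plus_def)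
  ultimately show ?thesis by (simp add: closed_circle_iff vimage_to_circle_add)
qed

lemma closed_set_plus_circle:
  fixes A B :: "circle set"
  assumes "closed A" "closed B"
  shows "closed (A + B)"
proof -
  have "compact (to_circle -` B \<inter> {0..1})"
    using assms closed_circle_iff by (intro closed_Int_compact) auto
  then have "closed (A + to_circle ` (to_circle -` B \<inter> {0..1}))"
    by (rule closed_plus_image_compact[OF assms(1)])
  then show ?thesis by (simp only: image_to_circle_fundamental)
qed

section \<open>Haar measure of translates and arcs\<close>

interpretation haar_circle: finite_measure haar_circle
  by standard (simp add: emeasure_haar_circle_UNIV)

lemma measure_haar_translate:
  assumes "S \<in> sets borel"
  shows "(+) a ` S \<in> sets borel" "measure haar_circle ((+) a ` S) = measure haar_circle S"
proof -
  have eq: "(+) a ` S = (\<lambda>y. - a + y) -` S"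
  proof (intro equalityI subsetI)
    fix x assume "x \<in> (\<lambda>y. - a + y) -` S"
    moreover have "x = a + (- a + x)" by simp
    ultimately show "x \<in> (+) a ` S" by blast
  qed auto
  show "(+) a ` S \<in> sets borel"
    unfolding eq using measurable_sets[OF measurable_plus_circle assms] by simp
  have "measure haar_circle S = measure (distr haar_circle borel (\<lambda>y. - a + y)) S"
    by (simp only: haar_circle_translation_invariant)
  also have "\<dots> = measure haar_circle ((\<lambda>y. - a + y) -` S)"
    using assms measurable_plus_circle by (subst measure_distr) (auto cong: measurable_cong_sets)
  finally show "measure haar_circle ((+) a ` S) = measure haar_circle S" by (simp add: eq)
qed

text \<open>The preimage of \<open>{0}\<close> is the closed set of integers, so this is the case
  \<open>A = {0}\<close> of adding a compact image to a closed set.\<close>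

lemma closed_to_circle_image:
  assumes "compact K"
  shows "closed (to_circle ` K)"
proof -
  have "to_circle -` {0} = \<int>"
    using to_circle_eq_iff[of _ 0] by (auto simp: zero_circle_def)
  then have "closed ({0} :: circle set)" by (simp add: closed_circle_iff closed_Ints)
  then have "closed ({0} + to_circle ` K)" using assms by (rule closed_plus_image_compact)
  then show ?thesis by (simp add: set_plus_def)
qed

lemma measure_haar_arc:
  assumes "I \<subseteq> {0..<1}" "to_circle ` I \<in> sets borel"
  shows "measure haar_circle (to_circle ` I) = measure lborel I"
proof -
  have "to_circle -` (to_circle ` I) \<inter> {0..<1} = I"
  proof (intro equalityI subsetI)
    fix x assume "x \<in> to_circle -` (to_circle ` I) \<inter> {0..<1}"
    then obtain y where y: "y \<in> I" "x - y \<in> \<int>" and x: "0 \<le> x" "x < 1"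
      by (auto simp: to_circle_eq_iff)
    moreover have "0 \<le> y" "y < 1" using y(1) assms(1) by auto
    ultimately have "x - y = 0" by (intro Ints_nonzero_abs_less1) auto
    then show "x \<in> I" using y(1) by simp
  qed (use assms(1) in auto)
  then show ?thesis using assms(2) by (simp add: measure_def emeasure_haar_circle)
qed

lemma measure_haar_closed_arc:
  fixes t :: real
  assumes "0 \<le> t" "t < 1"
  shows "measure haar_circle (to_circle ` {0..t}) = t"
  using assms by (subst measure_haar_arc) (auto intro!: borel_closed closed_to_circle_image)

lemma measure_haar_open_arc:
  fixes t :: real
  assumes "0 \<le> t" "t \<le> 1"
  shows "measure haar_circle (to_circle ` {0<..<t}) = t"
  using assms by (subst measure_haar_arc) (auto intro!: borel_open open_to_circle_image)

lemma measure_le_of_arc_cover: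
  fixes t :: real
  assumes "finite P" "X \<in> sets borel" "X \<subseteq> P + to_circle ` {0..t}" "0 \<le> t" "t < 1"
  shows "measure haar_circle X \<le> card P * t"
proof -
  let ?I = "to_circle ` {0..t}"
  have I: "?I \<in> sets borel" by (intro borel_closed closed_to_circle_image) auto
  have "X \<subseteq> (\<Union>g\<in>P. (+) g ` ?I)" using assms(3) by (fastforce simp: set_plus_def)
  then have "measure haar_circle X \<le> measure haar_circle (\<Union>g\<in>P. (+) g ` ?I)"
    using measure_haar_translate(1)[OF I] assms(1)
    by (intro haar_circle.finite_measure_mono) auto
  also have "\<dots> \<le> (\<Sum>g\<in>P. measure haar_circle ((+) g ` ?I))"
    using measure_haar_translate(1)[OF I] assms(1)
    by (intro haar_circle.finite_measure_subadditive_finite) auto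
  also have "\<dots> = card P * t"
    using measure_haar_translate(2)[OF I] measure_haar_closed_arc assms(4,5) by simp
  finally show ?thesis .
qed

section \<open>Counting torsion points by measure\<close>

lemma circle_cis_to_circle_power: "circle_cis (to_circle u) ^ n = circle_cis (to_circle (real n * u))"
  by (simp add: circle_cis.abs_eq Complex.DeMoivre mult.left_commute)

lemma torsion_arc_eq_0:
  assumes "circle_cis (to_circle u) ^ n = 1" "\<bar>u\<bar> < 1 / real n"
  shows "u = 0"
proof -
  have "n > 0" using assms(2) by (cases n) auto
  have "to_circle (real n * u) = 0"
    using assms(1) by (simp add: circle_cis_to_circle_power circle_cis_eq_1_iff)
  then have "real n * u \<in> \<int>" using to_circle_eq_iff[of _ 0] by (simp add: zero_circle_def)
  moreover have "\<bar>real n * u\<bar> < 1" using assms(2) \<open>n > 0\<close> by (simp add: abs_mult field_simps)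
  ultimately have "real n * u = 0" by (rule Ints_nonzero_abs_less1)
  then show ?thesis using \<open>n > 0\<close> by simp
qed

text \<open>Distinct \<open>n\<close>-torsion points are at least \<open>1 / n\<close> apart, so the
  open arcs of length \<open>1 / n\<close> starting at them are disjoint and all lie in
  \<open>X\<close>.\<close>

lemma card_torsion_le_measure:
  assumes P: "finite P" "\<And>g. g \<in> P \<Longrightarrow> circle_cis g ^ n = 1" and "n > 0"
    and X: "X \<in> sets borel" "P + to_circle ` {0<..<1 / real n} \<subseteq> X"
  shows "real (card P) \<le> n * measure haar_circle X"
proof -
  let ?I = "to_circle ` {0<..<1 / real n}"
  have I: "?I \<in> sets borel" by (intro borel_open open_to_circle_image) auto
  have "disjoint_family_on (\<lambda>g. (+) g ` ?I) P"
    unfolding disjoint_family_on_def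
  proof (intro ballI impI equals0I)
    fix g h x assume gh: "g \<in> P" "h \<in> P" "g \<noteq> h" and "x \<in> (+) g ` ?I \<inter> (+) h ` ?I"
    then obtain u v where uv: "u \<in> {0<..<1 / real n}" "v \<in> {0<..<1 / real n}"
        "x = g + to_circle u" "x = h + to_circle v" by blast
    then have "g + to_circle u = h + to_circle v" by simp
    have "g - h = (g + to_circle u) - (h + to_circle u)" by simp
    also have "\<dots> = to_circle (v - u)"
      unfolding \<open>g + to_circle u = _\<close> to_circle_diff by simp
    finally have eq: "g - h = to_circle (v - u)" .
    have "circle_cis (to_circle (v - u)) ^ n = 1"
      using torsion_diff[OF P(2)[OF gh(1)] P(2)[OF gh(2)]] unfolding eq .
    moreover have "\<bar>v - u\<bar> < 1 / real n" using uv(1,2) by auto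
    ultimately have "v - u = 0" by (rule torsion_arc_eq_0)
    then have "g - h = 0" using eq by (simp add: zero_circle_def)
    then show False using gh(3) by simp
  qed
  then have "(\<Sum>g\<in>P. measure haar_circle ((+) g ` ?I)) = measure haar_circle (\<Union>g\<in>P. (+) g ` ?I)"
    using measure_haar_translate(1)[OF I] P(1)
    by (intro haar_circle.finite_measure_finite_Union[symmetric]) auto
  also have "\<dots> \<le> measure haar_circle X"
    using X by (intro haar_circle.finite_measure_mono) (auto simp: set_plus_def)
  also have "(\<Sum>g\<in>P. measure haar_circle ((+) g ` ?I)) = card P / n"
    using measure_haar_translate(2)[OF I] measure_haar_open_arc[of "1 / real n"] \<open>n > 0\<close> by simp
  finally show ?thesis using \<open>n > 0\<close> by (simp add: field_simps)
qed

text \<open>Continuity of the measure from above: the neighbourhoods decrease to the closure of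
  \<open>C\<close>, which is \<open>C\<close>.\<close>

lemma measure_neighbourhood_tendsto:
  assumes C: "closed C"
  shows "(\<lambda>n. measure haar_circle (C + to_circle ` {- (4 / real n)..4 / real n}))
    \<longlonglongrightarrow> measure haar_circle C"
proof -
  \<comment> \<open>The index is shifted because division by zero makes the radius at
    \<open>n = 0\<close> equal to 0, which would spoil monotonicity.\<close>
  define N where "N n = C + to_circle ` {- (4 / real (Suc n))..4 / real (Suc n)}" for n
  have "closed (N n)" for n unfolding N_def by (intro closed_plus_image_compact C) auto
  then have meas: "range N \<subseteq> sets haar_circle" by (auto intro: borel_closed)
  have "decseq N"
    unfolding N_def decseq_def
    by (intro allI impI set_plus_mono2 order_refl image_mono) (auto simp: field_simps)
  then have "(\<lambda>n. measure haar_circle (N n)) \<longlonglongrightarrow> measure haar_circle (\<Inter>n. N n)"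
    using meas by (intro haar_circle.finite_Lim_measure_decseq) auto
  also have "(\<Inter>n. N n) = C"
  proof (intro equalityI subsetI)
    fix z assume z: "z \<in> (\<Inter>n. N n)"
    obtain x where x: "z = to_circle x" by (rule to_circle_cases)
    have "x \<in> closure (to_circle -` C)"
      unfolding closure_approachable
    proof (intro allI impI)
      fix e :: real assume "e > 0"
      then obtain n where n: "4 / real (Suc n) < e"
        using reals_Archimedean[of "e / 4"] by (auto simp: field_simps)
      have "x \<in> to_circle -` N n" using z x by auto
      then obtain y d where "y \<in> to_circle -` C" "d \<in> {- (4 / real (Suc n))..4 / real (Suc n)}" "x = y + d"
        unfolding N_def vimage_to_circle_add by (rule set_plus_elim)
      then show "\<exists>y\<in>to_circle -` C. dist y x < e"
        using n by (intro bexI[of _ y]) (auto simp: dist_real_def)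
    qed
    then show "z \<in> C" using C x by (simp add: closed_circle_iff)
  next
    fix z assume "z \<in> C"
    moreover have "0 \<in> to_circle ` {- (4 / real (Suc n))..4 / real (Suc n)}" for n
      by (intro image_eqI[of _ _ 0]) (auto simp: zero_circle_def)
    ultimately have "z + 0 \<in> N n" for n unfolding N_def by (intro set_plus_intro)
    then show "z \<in> (\<Inter>n. N n)" by simp
  qed
  finally show ?thesis unfolding N_def by (rule LIMSEQ_imp_Suc)
qed

text \<open>The radius \<open>1 / n\<close> admits both grid points surrounding each point of
  \<open>A\<close>, so coordinates may be rounded down or up.\<close>

definition grid_nbhd :: "nat \<Rightarrow> circle set \<Rightarrow> circle set" where
  "grid_nbhd n A = {g. circle_cis g ^ n = 1 \<and> g \<in> A + to_circle ` {- (1 / real n)..1 / real n}}"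

lemma finite_torsion:
  assumes "n > 0"
  shows "finite {g. circle_cis g ^ n = 1}"
proof (rule finite_imageD)
  have "circle_cis ` {g. circle_cis g ^ n = 1} \<subseteq> {z. z ^ n = 1}" by auto
  then show "finite (circle_cis ` {g. circle_cis g ^ n = 1})"
    using finite_roots_unity[of n, where 'a = complex] assms finite_subset by auto
  show "inj_on circle_cis {g. circle_cis g ^ n = 1}"
  proof (rule inj_onI)
    fix x y assume "circle_cis x = circle_cis y"
    then have "circle_cis (x - y) = 1"
      by (simp add: circle_cis_diff complex_norm_square[symmetric])
    then show "x = y" by (simp add: circle_cis_eq_1_iff)
  qed
qed

lemma to_circle_arc_add:
  "to_circle ` {- s..s} + to_circle ` {- t..t} \<subseteq> to_circle ` {- (s + t)..s + t}"
proof
  fix x assume "x \<in> to_circle ` {- s..s} + to_circle ` {- t..t}"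
  then obtain u v where "u \<in> {- s..s}" "v \<in> {- t..t}" "x = to_circle u + to_circle v"
    by (auto elim!: set_plus_elim)
  then show "x \<in> to_circle ` {- (s + t)..s + t}"
    by (intro image_eqI[of _ _ "u + v"]) (auto simp: to_circle_add)
qed

text \<open>Rounding both coordinates down leaves an error \<open>(f + g) / n\<close>, possibly
  beyond \<open>1 / n\<close>; in that case one coordinate is rounded up instead. Arcs of length
  \<open>1 / n\<close>, not \<open>2 / n\<close>, keep the later measure bound free of a factor
  2.\<close>

lemma grid_nbhd_double_cover:
  assumes "n > 0"
  shows "A + A \<subseteq> grid_nbhd n A + grid_nbhd n A + to_circle ` {0..1 / real n}"
proof
  fix z assume "z \<in> A + A"
  then obtain a b where ab: "a \<in> A" "b \<in> A" "z = a + b" by (auto simp: set_plus_def)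
  obtain x y where xy: "a = to_circle x" "b = to_circle y" by (metis to_circle_cases)
  define j k where "j = \<lfloor>n * x\<rfloor>" and "k = \<lfloor>n * y\<rfloor>"
  have grid: "to_circle (i / n) \<in> grid_nbhd n A"
    if "to_circle t \<in> A" "\<bar>i / n - t\<bar> \<le> 1 / n" for i :: int and t :: real
  proof -
    have "circle_cis (to_circle (i / n)) ^ n = circle_cis (to_circle (of_int i))"
      using assms by (simp add: circle_cis_to_circle_power)
    also have "to_circle (of_int i) = 0" by (simp add: zero_circle_def to_circle_eq_iff)
    finally have "circle_cis (to_circle (i / n)) ^ n = 1" by (simp add: circle_cis_eq_1_iff)
    moreover have "to_circle t + to_circle (i / n - t) \<in> A + to_circle ` {- (1 / real n)..1 / real n}"
      using that by (intro set_plus_intro imageI) (auto simp: abs_le_iff)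
    moreover have "to_circle t + to_circle (i / n - t) = to_circle (i / n)"
      by (simp add: to_circle_add[symmetric])
    ultimately show ?thesis unfolding grid_nbhd_def by simp
  qed
  define f g where "f = n * x - j" and "g = n * y - k"
  have fg: "0 \<le> f" "f < 1" "0 \<le> g" "g < 1"
    unfolding f_def g_def j_def k_def by linarith+
  have x: "x = (j + f) / n" "y = (k + g) / n"
    using assms by (simp_all add: f_def g_def)
  have mem: "to_circle (j / n) \<in> grid_nbhd n A" "to_circle ((j + 1) / n) \<in> grid_nbhd n A"
      "to_circle (k / n) \<in> grid_nbhd n A"
    using ab fg assms grid[of x j] grid[of x "j + 1"] grid[of y k]
    by (auto simp: xy x field_simps abs_if)
  show "z \<in> grid_nbhd n A + grid_nbhd n A + to_circle ` {0..1 / real n}"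
  proof (cases "f + g < 1")
    case True
    have "z = to_circle (j / n) + to_circle (k / n) + to_circle ((f + g) / n)"
      unfolding ab(3) xy x to_circle_add[symmetric] by (simp add: add_divide_distrib algebra_simps)
    moreover have "(f + g) / n \<in> {0..1 / real n}" using True fg by (auto intro: divide_right_mono)
    ultimately show ?thesis using mem by (metis set_plus_intro imageI)
  next
    case False
    have "z = to_circle ((j + 1) / n) + to_circle (k / n) + to_circle ((f + g - 1) / n)"
      unfolding ab(3) xy x to_circle_add[symmetric]
      by (simp add: add_divide_distrib diff_divide_distrib algebra_simps)
    moreover have "(f + g - 1) / n \<in> {0..1 / real n}" using False fg by (auto intro: divide_right_mono)
    ultimately show ?thesis using mem by (metis set_plus_intro imageI)
  qed
qed

lemma closed_arc_neighbourhood_measurable: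
  "closed C \<Longrightarrow> C + to_circle ` {s..t} \<in> sets borel"
  by (intro borel_closed closed_plus_image_compact) auto

lemma grid_nbhd_subset: "grid_nbhd n A \<subseteq> A + to_circle ` {- (1 / real n)..1 / real n}"
  by (auto simp: grid_nbhd_def)

lemma grid_nbhd_sum_subset:
  assumes "P \<subseteq> C + to_circle ` {- s..s}"
  shows "P + grid_nbhd n A \<subseteq> (C + A) + to_circle ` {- (s + 1 / real n)..s + 1 / real n}"
proof -
  let ?I = "to_circle ` {- s..s}" and ?J = "to_circle ` {- (1 / real n)..1 / real n}"
  have "P + grid_nbhd n A \<subseteq> (C + ?I) + (A + ?J)"
    by (intro set_plus_mono2 assms grid_nbhd_subset)
  also have "\<dots> = (C + A) + (?I + ?J)" by (simp add: ac_simps)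
  also have "\<dots> \<subseteq> (C + A) + to_circle ` {- (s + 1 / real n)..s + 1 / real n}"
    by (intro set_plus_mono2 order_refl to_circle_arc_add)
  finally show ?thesis .
qed

text \<open>Radius \<open>3 / n\<close> accommodates three rounded summands; the disjoint arcs
  attached to the torsion points add another \<open>1 / n\<close>.\<close>

lemma card_grid_le_measure:
  assumes "closed C" "n > 0" "P \<subseteq> C + to_circle ` {- (3 / real n)..3 / real n}"
    and "\<And>g. g \<in> P \<Longrightarrow> circle_cis g ^ n = 1"
  shows "real (card P) \<le> n * measure haar_circle (C + to_circle ` {- (4 / real n)..4 / real n})"
proof (rule card_torsion_le_measure)
  show "finite P" by (rule finite_subset[OF _ finite_torsion[OF assms(2)]]) (use assms(4) in auto)
  have arc: "to_circle ` {0<..<1 / real n} \<subseteq> to_circle ` {- (1 / real n)..1 / real n}"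
    by (intro image_mono) auto
  have "P + to_circle ` {0<..<1 / real n}
      \<subseteq> C + to_circle ` {- (3 / real n)..3 / real n} + to_circle ` {- (1 / real n)..1 / real n}"
    by (intro set_plus_mono2 assms(3) arc)
  also have "\<dots> \<subseteq> C + to_circle ` {- (3 / real n + 1 / real n)..3 / real n + 1 / real n}"
    unfolding add.assoc by (intro set_plus_mono2 order_refl to_circle_arc_add)
  also have "3 / real n + 1 / real n = 4 / real n" by (simp add: add_divide_distrib[symmetric])
  finally show "P + to_circle ` {0<..<1 / real n} \<subseteq> C + to_circle ` {- (4 / real n)..4 / real n}" .
qed (use assms closed_arc_neighbourhood_measurable in auto)

theorem theorem1p7:
  shows "\<exists>c::real. c > 0 \<and>
    (\<forall>A :: circle set. closed A \<longrightarrow> measure haar_circle (A + A) < c \<longrightarrow>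
      measure haar_circle (A + A + A) \<ge> 3 / 2 * measure haar_circle (A + A))"
proof -
  obtain c :: real where c: "c > 0" and torsion: "\<And>p A. prime p \<Longrightarrow> finite A \<Longrightarrow> A \<noteq> {} \<Longrightarrow>
      (\<forall>a\<in>A. circle_cis a ^ p = 1) \<Longrightarrow> real (card (A + A)) \<le> c * real p \<Longrightarrow>
      3 * card (A + A) \<le> 2 * card (A + A + A) + 3"
    using torsion_tripling by blast
  show ?thesis
  proof (intro exI[of _ c] conjI c allI impI)
    fix A :: "circle set"
    assume A: "closed A" and small: "measure haar_circle (A + A) < c"
    define \<mu> where "\<mu> = measure haar_circle"
    define N where "N C n = C + to_circle ` {- (4 / real n)..4 / real n}" for C n
    have A2: "closed (A + A)" and A3: "closed (A + A + A)"
      using A by (auto intro: closed_set_plus_circle)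
    show "3 / 2 * measure haar_circle (A + A) \<le> measure haar_circle (A + A + A)"
    proof (cases "A = {}")
      case True
      then show ?thesis by (simp add: set_plus_def)
    next
      case False
      have lim2: "(\<lambda>n. \<mu> (N (A + A) n)) \<longlonglongrightarrow> \<mu> (A + A)"
        and lim3: "(\<lambda>n. \<mu> (N (A + A + A) n)) \<longlonglongrightarrow> \<mu> (A + A + A)"
        unfolding \<mu>_def N_def using A2 A3 by (auto intro: measure_neighbourhood_tendsto)
      \<comment> \<open>The term \<open>3 / real n\<close> is the additive error 3 of the torsion
        bound after division by \<open>p\<close>; it vanishes in the limit.\<close>
      have "(\<lambda>n. 2 * \<mu> (N (A + A + A) n) + 3 / real n) \<longlonglongrightarrow> 2 * \<mu> (A + A + A) + 0"
        by (intro tendsto_add tendsto_mult_left lim3 lim_const_over_n)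
      show ?thesis
      proof (rule ccontr)
        assume "\<not> ?thesis"
        then have "2 * \<mu> (A + A + A) + 0 < 3 * \<mu> (A + A)" by (simp add: \<mu>_def)
        then have "eventually (\<lambda>n. 2 * \<mu> (N (A + A + A) n) + 3 / real n < 3 * \<mu> (A + A)) sequentially"
          using \<open>_ \<longlonglongrightarrow> 2 * \<mu> (A + A + A) + 0\<close> order_tendstoD(2) by blast
        moreover have "eventually (\<lambda>n. \<mu> (N (A + A) n) < c) sequentially"
          using lim2 small order_tendstoD(2) unfolding \<mu>_def by blast
        ultimately have "eventually (\<lambda>n. 2 * \<mu> (N (A + A + A) n) + 3 / real n < 3 * \<mu> (A + A)
            \<and> \<mu> (N (A + A) n) < c) sequentially"
          by eventually_elim simp
        then obtain n0 where n0: "\<And>n. n \<ge> n0 \<Longrightarrow> 2 * \<mu> (N (A + A + A) n) + 3 / real n < 3 * \<mu> (A + A)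
            \<and> \<mu> (N (A + A) n) < c"
          by (auto simp: eventually_sequentially)
        \<comment> \<open>Primes are unbounded, so the torsion bound is available beyond the
          threshold \<open>n0\<close>.\<close>
        obtain p where p: "prime p" "p > n0" using bigger_prime by blast
        have p1: "p > 1" using p(1) by (rule prime_gt_1_nat)
        define D where "D = grid_nbhd p A"
        have tors: "\<forall>a\<in>D. circle_cis a ^ p = 1" by (simp add: D_def grid_nbhd_def)
        have tors2: "circle_cis g ^ p = 1" if "g \<in> D + D" for g
          using that tors by (auto simp: set_plus_def torsion_add)
        have tors3: "circle_cis g ^ p = 1" if "g \<in> D + D + D" for g
          using that tors2 tors by (auto elim!: set_plus_elim intro!: torsion_add)
        have finD: "finite D"
          by (rule finite_subset[OF _ finite_torsion[of p]]) (use p1 tors in auto)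
        have cover: "A + A \<subseteq> D + D + to_circle ` {0..1 / real p}"
          unfolding D_def using p1 by (intro grid_nbhd_double_cover) auto
        have "D \<noteq> {}"
        proof
          assume "D = {}"
          then have "A + A = {}" using cover by (auto simp: set_plus_def)
          then show False using False by (auto simp: set_plus_def)
        qed
        have sub1: "D \<subseteq> A + to_circle ` {- (1 / real p)..1 / real p}"
          unfolding D_def by (rule grid_nbhd_subset)
        have sub2: "D + D \<subseteq> A + A + to_circle ` {- (2 / real p)..2 / real p}"
          using grid_nbhd_sum_subset[OF sub1, of p A] by (simp add: D_def add_divide_distrib[symmetric])
        have sub3: "D + D + D \<subseteq> A + A + A + to_circle ` {- (3 / real p)..3 / real p}"
          using grid_nbhd_sum_subset[OF sub2, of p A] by (simp add: D_def add_divide_distrib[symmetric])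
        \<comment> \<open>The counting lemma is stated for radius \<open>3 / p\<close>, so the
          double sumset is placed in the wider neighbourhood.\<close>
        have "to_circle ` {- (2 / real p)..2 / real p} \<subseteq> to_circle ` {- (3 / real p)..3 / real p}"
          using p1 by (intro image_mono) (auto simp: field_simps)
        then have sub2': "D + D \<subseteq> A + A + to_circle ` {- (3 / real p)..3 / real p}"
          using sub2 set_plus_mono2[OF order_refl] by (meson order_trans)
        have card2: "real (card (D + D)) \<le> p * \<mu> (N (A + A) p)"
          unfolding \<mu>_def N_def using p1 tors2 by (intro card_grid_le_measure A2 sub2') auto
        have card3: "real (card (D + D + D)) \<le> p * \<mu> (N (A + A + A) p)"
          unfolding \<mu>_def N_def using p1 tors3 by (intro card_grid_le_measure A3 sub3) auto
        have "p * \<mu> (N (A + A) p) \<le> p * c"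
          using n0[of p] p(2) by (intro mult_left_mono) auto
        then have "real (card (D + D)) \<le> c * p" using card2 by (simp add: mult.commute)
        then have "3 * card (D + D) \<le> 2 * card (D + D + D) + 3"
          using torsion[OF p(1) finD \<open>D \<noteq> {}\<close> tors] by blast
        \<comment> \<open>A failure in the limit forces
          \<open>card (D + D) < p * \<mu> (A + A)\<close>, whereas covering \<open>A + A\<close> by
          \<open>card (D + D)\<close> arcs of length \<open>1 / p\<close> gives the reverse
          inequality.\<close>
        then have "3 * real (card (D + D)) \<le> 2 * real (card (D + D + D)) + 3" by linarith
        also have "\<dots> \<le> 2 * (p * \<mu> (N (A + A + A) p)) + 3" using card3 by simp
        also have "\<dots> = p * (2 * \<mu> (N (A + A + A) p) + 3 / p)"
          using p1 by (simp add: field_simps)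
        also have "\<dots> < p * (3 * \<mu> (A + A))"
          using n0[of p] p(2) p1 by (intro mult_strict_left_mono) auto
        finally have "real (card (D + D)) < p * \<mu> (A + A)" by simp
        moreover have "\<mu> (A + A) \<le> card (D + D) * (1 / real p)"
          unfolding \<mu>_def using p1 finD A2 cover
          by (intro measure_le_of_arc_cover) (auto intro: finite_set_plus borel_closed)
        ultimately show False using p1 by (simp add: field_simps)
      qed
    qed
  qed
qed

end
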